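(* Let $k\ge 2$ be an integer and let $G$ be a $\{C_5,C_{2k}\}$-free graph with $\Delta(G)\ge 1$. Then: (i) if $k\ge 4$, then $\omega'_S(G)\le k\Delta(G)-(k-1)$; (ii) if $k\in\{2,3\}$ and $G$ is also $C_3$-free, then $\omega'_S(G)\le k\Delta(G)-(k-1)$.
   Context: All graphs are finite and simple. $\Delta(G)$ is the maximum degree of $G$. $C_n$ denotes the cycle on $n$ vertices; a graph is $\mathcal{F}$-free for a set $\mathcal{F}$ of graphs if it contains no subgraph (not necessarily induced) isomorphic to a member of $\mathcal{F}$. The distance between two edges of $G$ is the distance between the corresponding vertices in the line graph of $G$. A strong clique of $G$ is a set $S$ of edges such that every pair of edges in $S$ has distance at most $2$. The strong clique number $\omega'_S(G)$ is the maximum size of a strong clique of $G$. *)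

theory Defs
  imports Complex_Main "HOL-Library.Extended_Nat"
begin

datatype 'a graph = Graph (verts: "'a set") (edges: "'a set set")

definition simple_graph :: "'a graph \<Rightarrow> bool" where
  "simple_graph G \<longleftrightarrow>
     finite (verts G) \<and> (\<forall>e\<in>edges G. e \<subseteq> verts G \<and> card e = 2)"

definition degree :: "'a graph \<Rightarrow> 'a \<Rightarrow> nat" where
  "degree G v = card {e \<in> edges G. v \<in> e}"

(* The inserted 0 fixes the value for the graph without vertices, where Max {} is unspecified. *)
definition max_degree :: "'a graph \<Rightarrow> nat" where
  "max_degree G = Max (insert 0 (degree G ` verts G))"

definition subgraph :: "'a graph \<Rightarrow> 'a graph \<Rightarrow> bool" where
  "subgraph H G \<longleftrightarrow> simple_graph H \<and> verts H \<subseteq> verts G \<and> edges H \<subseteq> edges G"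

definition graph_iso :: "'a graph \<Rightarrow> 'b graph \<Rightarrow> bool" where
  "graph_iso G H \<longleftrightarrow>
     (\<exists>f. bij_betw f (verts G) (verts H) \<and> edges H = (\<lambda>e. f ` e) ` edges G)"

definition graph_free :: "'b graph set \<Rightarrow> 'a graph \<Rightarrow> bool" where
  "graph_free \<F> G \<longleftrightarrow> \<not> (\<exists>F\<in>\<F>. \<exists>H. subgraph H G \<and> graph_iso F H)"

(* This is the n-vertex cycle (and a simple graph) only for n \<ge> 3. *)
definition cycle_graph :: "nat \<Rightarrow> nat graph" where
  "cycle_graph n = Graph {..<n} ((\<lambda>i. {i, (i + 1) mod n}) ` {..<n})"

definition path_between :: "'a graph \<Rightarrow> 'a \<Rightarrow> 'a list \<Rightarrow> 'a \<Rightarrow> bool" where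
  "path_between G u p v \<longleftrightarrow>
     p \<noteq> [] \<and> hd p = u \<and> last p = v \<and> set p \<subseteq> verts G \<and> distinct p \<and>
     successively (\<lambda>x y. {x, y} \<in> edges G) p"

(* A path is the list of its vertices, so its length is one less than that of the list.
   The infimum of the empty set is \<infinity>, the distance between different components. *)
definition graph_dist :: "'a graph \<Rightarrow> 'a \<Rightarrow> 'a \<Rightarrow> enat" where
  "graph_dist G u v = (INF p \<in> {p. path_between G u p v}. enat (length p - 1))"

definition line_graph :: "'a graph \<Rightarrow> 'a set graph" where
  "line_graph G =
     Graph (edges G) {{e, f} | e f. e \<in> edges G \<and> f \<in> edges G \<and> e \<noteq> f \<and> e \<inter> f \<noteq> {}}"

definition edge_dist :: "'a graph \<Rightarrow> 'a set \<Rightarrow> 'a set \<Rightarrow> enat" where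
  "edge_dist G = graph_dist (line_graph G)"

definition strong_clique :: "'a graph \<Rightarrow> 'a set set \<Rightarrow> bool" where
  "strong_clique G S \<longleftrightarrow> S \<subseteq> edges G \<and> (\<forall>e\<in>S. \<forall>f\<in>S. edge_dist G e f \<le> 2)"

definition strong_clique_number :: "'a graph \<Rightarrow> nat" where
  "strong_clique_number G = Max (card ` {S. strong_clique G S})"

end

theory Submission
  imports Defs
begin

text \<open>
  Let \<open>\<Delta>\<close> be the maximum degree and \<open>S\<close> a strong clique, so that any two disjoint edges of \<open>S\<close> are joined
  by a linking edge. If the edges of \<open>S\<close> and the linking edges span a triangle \<open>xyz\<close>, then
  forbidding \<open>C\<^sub>5\<close> makes every edge of \<open>S\<close> disjoint from \<open>xyz\<close> contain the same vertex, a common neighbour of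
  two of \<open>x, y, z\<close>; hence \<open>S\<close> is covered by four vertices including a triangle and
  \<open>|S| \<le> 4\<Delta> - 3\<close>. Otherwise these edges form a bipartite graph.

  In the bipartite case \<open>|S| \<le> \<Delta>\<^sup>2\<close> always holds, which suffices for \<open>\<Delta> < k\<close>. For \<open>\<Delta> \<ge> k\<close>, orient each
  pair of edges in a matching of \<open>S\<close> by its linking edge. Moon's argument on cycles in tournaments
  turns a matching of size \<open>k + 1\<close> into a \<open>C\<^bsub>2k\<^esub>\<close> when \<open>k \<ge> 3\<close>, so by Koenig's theorem \<open>k\<close> vertices cover
  \<open>S\<close>. If \<open>|S| > k\<Delta> - (k - 1)\<close>, few of these vertices have \<open>S\<close>-degree less than \<open>\<Delta>\<close>, and a vertex whose
  \<open>S\<close>-degree is \<open>\<Delta>\<close> absorbs the \<open>S\<close>-neighbourhoods of all vertices on its side. This forces the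
  cover to lie on one side, with all \<open>S\<close>-neighbours in a set of \<open>\<Delta>\<close> vertices and at most \<open>k - 2\<close>
  missing edges in between, and such a dense bipartite graph contains \<open>C\<^bsub>2k\<^esub>\<close>.
\<close>

section \<open>Semicomplete digraphs\<close>

text \<open>Cut just before the first vertex that \<open>x\<close> dominates: its predecessor is not
  dominated by \<open>x\<close>, so by semicompleteness it dominates \<open>x\<close>.\<close>

lemma path_split:
  assumes "successively R ps" "ps \<noteq> []" "\<not> R x (hd ps)" "R x (last ps)"
    and "\<And>p. p \<in> set ps \<Longrightarrow> R x p \<or> R p x"
  shows "\<exists>us vs. ps = us @ vs \<and> us \<noteq> [] \<and> vs \<noteq> [] \<and> R (last us) x \<and> R x (hd vs)"
  using assms
proof (induction ps)
  case (Cons p ps)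
  show ?case
  proof (cases "ps = []")
    case True
    then show ?thesis using Cons.prems by simp
  next
    case False
    have px: "R p x" using Cons.prems by auto
    show ?thesis
    proof (cases "R x (hd ps)")
      case True
      then have "p # ps = [p] @ ps \<and> R (last [p]) x" using px by simp
      then show ?thesis using True False by blast
    next
      case hd: False
      have "\<exists>us vs. ps = us @ vs \<and> us \<noteq> [] \<and> vs \<noteq> [] \<and> R (last us) x \<and> R x (hd vs)"
        using Cons.prems False hd by (intro Cons.IH) (auto simp: successively_Cons)
      then obtain us vs where "ps = us @ vs" "us \<noteq> []" "vs \<noteq> []" "R (last us) x" "R x (hd vs)"
        by blast
      then show ?thesis by (intro exI[of _ "p # us"] exI[of _ vs]) auto
    qed
  qed
qed simp

text \<open>Redei's theorem by insertion: a new vertex goes to the front, to the end, or into the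
  gap found by \<open>path_split\<close>.\<close>

lemma hamiltonian_path:
  assumes "finite P" "\<And>p q. p \<in> P \<Longrightarrow> q \<in> P \<Longrightarrow> R p q \<or> R q p"
  shows "\<exists>ps. set ps = P \<and> distinct ps \<and> successively R ps"
  using assms
proof (induction P rule: finite_induct)
  case empty
  then show ?case by simp
next
  case (insert x P)
  then obtain ps where ps: "set ps = P" "distinct ps" "successively R ps" by auto
  have semi: "R x p \<or> R p x" if "p \<in> set ps" for p using insert.prems that ps by auto
  consider "ps = []" | "R x (hd ps)" "ps \<noteq> []" | "\<not> R x (last ps)" "ps \<noteq> []"
    | "\<not> R x (hd ps)" "R x (last ps)" "ps \<noteq> []" by blast
  then show ?case
  proof cases
    case 1
    then show ?thesis using ps by (intro exI[of _ "[x]"]) auto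
  next
    case 2
    then show ?thesis using ps insert.hyps
      by (intro exI[of _ "x # ps"]) (auto simp: successively_Cons)
  next
    case 3
    then have "R (last ps) x" using semi[of "last ps"] by auto
    then show ?thesis using ps insert.hyps
      by (intro exI[of _ "ps @ [x]"]) (auto simp: successively_append_iff)
  next
    case 4
    obtain us vs where "ps = us @ vs" "us \<noteq> []" "vs \<noteq> []" "R (last us) x" "R x (hd vs)"
      using path_split[OF ps(3) 4(3,1,2) semi] by blast
    then show ?thesis using ps insert.hyps
      by (intro exI[of _ "us @ x # vs"]) (auto simp: successively_append_iff successively_Cons)
  qed
qed

text \<open>Moon's argument: vary a Hamiltonian path \<open>a, b, c, d, ..., z\<close>. Either
  dropping one of \<open>a\<close>, \<open>b\<close>, \<open>c\<close> closes a cycle of length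
  \<open>k\<close>, or some Hamiltonian path has an arc from its first to its last vertex. The
  latter is no directed cycle, but \<open>matching_bicycle\<close> can use it equally well.\<close>

lemma near_hamiltonian_cycle:
  assumes "card P = Suc k" "3 \<le> k" "\<And>p q. p \<in> P \<Longrightarrow> q \<in> P \<Longrightarrow> R p q \<or> R q p"
  shows "\<exists>ps. distinct ps \<and> set ps \<subseteq> P \<and> successively R ps \<and>
    (length ps = k \<and> R (last ps) (hd ps) \<or> length ps = Suc k \<and> R (hd ps) (last ps))"
proof -
  have "finite P" using assms(1) card.infinite by fastforce
  then obtain ps where ps: "set ps = P" "distinct ps" "successively R ps"
    using hamiltonian_path[of P R] assms(3) by blast
  have len: "length ps = Suc k" using ps assms(1) distinct_card by metis
  obtain a b c d qs where eq: "ps = a # b # c # d # qs"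
  proof -
    have "4 \<le> length ps" using len assms(2) by simp
    then show thesis using that by (auto simp: numeral_eq_Suc Suc_le_length_iff)
  qed
  let ?z = "last (d # qs)"
  have semi: "R p q \<or> R q p" if "p \<in> set ps" "q \<in> set ps" for p q using assms(3) ps that by auto
  have path: "R a b" "R b c" "R c d" "successively R (d # qs)" using ps(3) eq by auto
  have z: "?z \<in> set ps" using eq by auto
  consider "R a ?z" | "R ?z a" "R a c" | "R ?z a" "R b d" | "R ?z b"
    | "R ?z a" "R c a" "\<not> R b d" "R b ?z"
    using semi z eq by (metis list.set_intros)
  then show ?thesis
  proof cases
    case 1
    then show ?thesis using ps len eq by (intro exI[of _ ps]) auto
  next
    case 2
    then show ?thesis using ps len eq path by (intro exI[of _ "a # c # d # qs"]) auto
  next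
    case 3
    then show ?thesis using ps len eq path
      by (intro exI[of _ "a # b # d # qs"]) (auto simp: successively_Cons)
  next
    case 4
    then show ?thesis using ps len eq path by (intro exI[of _ "b # c # d # qs"]) auto
  next
    case 5
    obtain us vs where uv: "d # qs = us @ vs" "us \<noteq> []" "vs \<noteq> []" "R (last us) b" "R b (hd vs)"
      using path_split[OF path(4), of b] 5 semi eq by auto
    \<comment> \<open>Move \<open>b\<close> into the tail \<open>d, ..., z\<close> and append
      \<open>a\<close> after \<open>z\<close>; the arc from \<open>c\<close> to \<open>a\<close>
      then leads from the first to the last vertex.\<close>
    let ?rs = "c # us @ b # vs @ [a]"
    have ps': "ps = a # b # c # us @ vs" using eq uv by simp
    have "successively R (us @ vs)" using path(4) uv(1) by simp
    moreover have "hd us = d" "last vs = ?z" using uv(1-3) by (metis hd_append2 list.sel(1), simp)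
    then have "R c (hd us)" "R (last vs) a" using path(3) 5(1) by simp_all
    ultimately have "successively R ?rs"
      using uv by (auto simp: successively_append_iff successively_Cons)
    moreover have "distinct ?rs" "set ?rs \<subseteq> P" "length ?rs = Suc k"
      using ps len ps' by auto
    ultimately show ?thesis using 5 by (intro exI[of _ ?rs]) auto
  qed
qed

text \<open>Uncrossing: if neither given cover covers all of \<open>T\<close>, then
  \<open>I1 \<inter> I2\<close> with \<open>J1 \<union> J2\<close>, and
  \<open>insert x (I1 \<union> I2)\<close> with \<open>J1 \<inter> J2\<close>, are both covers of
  \<open>T\<close>. Their sizes add up to at most \<open>2 * n + 1\<close>, so one of them has size
  at most \<open>n\<close>.\<close>

lemma koenig_share:
  fixes T :: "('a \<times> 'b) set"
  assumes "(x, y) \<in> T" "(x, z) \<in> T" "y \<noteq> z"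
    and fin: "finite I1" "finite J1" "finite I2" "finite J2"
    and c1: "card I1 + card J1 \<le> n" "T - {(x, y)} \<subseteq> {(a, b). a \<in> I1 \<or> b \<in> J1}"
    and c2: "card I2 + card J2 \<le> n" "T - {(x, z)} \<subseteq> {(a, b). a \<in> I2 \<or> b \<in> J2}"
  shows "\<exists>I J. finite I \<and> finite J \<and> card I + card J \<le> n \<and> T \<subseteq> {(a, b). a \<in> I \<or> b \<in> J}"
proof (rule ccontr)
  assume no: "\<not> ?thesis"
  have no': "n < card I + card J" if "finite I" "finite J" "T \<subseteq> {(a, b). a \<in> I \<or> b \<in> J}" for I J
    using no that by (meson not_le)
  have "\<not> T \<subseteq> {(a, b). a \<in> I1 \<or> b \<in> J1}" "\<not> T \<subseteq> {(a, b). a \<in> I2 \<or> b \<in> J2}"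
    using no fin c1(1) c2(1) by blast+
  then have "x \<notin> I1" "y \<notin> J1" "x \<notin> I2" "z \<notin> J2" using c1(2) c2(2) by auto
  then have "z \<in> J1" "y \<in> J2" using assms(1-3) c1(2) c2(2) by auto
  have "T \<subseteq> {(a, b). a \<in> I1 \<inter> I2 \<or> b \<in> J1 \<union> J2}"
    using c1(2) c2(2) \<open>z \<in> J1\<close> \<open>y \<in> J2\<close> by auto
  then have "n < card (I1 \<inter> I2) + card (J1 \<union> J2)" using fin by (intro no') auto
  moreover have "T \<subseteq> {(a, b). a \<in> insert x (I1 \<union> I2) \<or> b \<in> J1 \<inter> J2}"
    using c1(2) c2(2) by auto
  then have "n < card (insert x (I1 \<union> I2)) + card (J1 \<inter> J2)" using fin by (intro no') auto
  moreover have "card (insert x (I1 \<union> I2)) \<le> Suc (card (I1 \<union> I2))" by (rule card_insert_le_m1) auto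
  moreover have "card (I1 \<union> I2) + card (I1 \<inter> I2) = card I1 + card I2"
    "card (J1 \<union> J2) + card (J1 \<inter> J2) = card J1 + card J2"
    using fin card_Un_Int by metis+
  ultimately show False using c1(1) c2(1) by linarith
qed

section \<open>Koenig's theorem\<close>

text \<open>Delete edges as long as no cover of size \<open>n\<close> appears. In a critical
  \<open>T\<close>, two edges with a common end would contradict \<open>koenig_share\<close>,
  applied to the converse for right ends, so \<open>T\<close> is a matching. It has more than
  \<open>n\<close> edges, since its left ends form a cover.\<close>

lemma koenig:
  fixes T :: "('a \<times> 'b) set"
  assumes "finite T"
    and "\<nexists>I J. finite I \<and> finite J \<and> card I + card J \<le> n \<and> T \<subseteq> {(a, b). a \<in> I \<or> b \<in> J}"
  shows "\<exists>M \<subseteq> T. inj_on fst M \<and> inj_on snd M \<and> card M = Suc n"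
  using assms
proof (induction "card T" arbitrary: T rule: less_induct)
  case less
  let ?cov = "\<lambda>U. \<exists>I J. finite I \<and> finite J \<and> card I + card J \<le> n \<and>
    (U :: ('a \<times> 'b) set) \<subseteq> {(a, b). a \<in> I \<or> b \<in> J}"
  show ?case
  proof (cases "\<exists>e\<in>T. \<not> ?cov (T - {e})")
    case True
    then obtain e where e: "e \<in> T" "\<not> ?cov (T - {e})" by blast
    have "card (T - {e}) < card T" using e less.prems(1) by (meson card_Diff1_less)
    then have "\<exists>M \<subseteq> T - {e}. inj_on fst M \<and> inj_on snd M \<and> card M = Suc n"
      using e less.prems by (intro less.hyps) auto
    then show ?thesis by blast
  next
    case False
    then have crit: "?cov (T - {e})" if "e \<in> T" for e using that by blast
    have "inj_on fst T"
    proof (rule inj_onI)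
      fix p q assume pq: "p \<in> T" "q \<in> T" "fst p = fst q"
      obtain x y z where eq: "p = (x, y)" "q = (x, z)" using pq(3) by (metis prod.collapse)
      obtain I1 J1 I2 J2 where c: "finite I1" "finite J1" "finite I2" "finite J2"
        "card I1 + card J1 \<le> n" "T - {(x, y)} \<subseteq> {(a, b). a \<in> I1 \<or> b \<in> J1}"
        "card I2 + card J2 \<le> n" "T - {(x, z)} \<subseteq> {(a, b). a \<in> I2 \<or> b \<in> J2}"
        using crit[OF pq(1)] crit[OF pq(2)] unfolding eq by blast
      show "p = q"
        using koenig_share[OF pq(1,2)[unfolded eq] _ c] less.prems(2) eq by blast
    qed
    moreover have "inj_on snd T"
    proof (rule inj_onI)
      fix p q assume pq: "p \<in> T" "q \<in> T" "snd p = snd q"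
      obtain x y z where eq: "p = (y, x)" "q = (z, x)" using pq(3) by (metis prod.collapse)
      obtain I1 J1 I2 J2 where c: "finite J1" "finite I1" "finite J2" "finite I2"
        "card J1 + card I1 \<le> n" "T\<inverse> - {(x, y)} \<subseteq> {(a, b). a \<in> J1 \<or> b \<in> I1}"
        "card J2 + card I2 \<le> n" "T\<inverse> - {(x, z)} \<subseteq> {(a, b). a \<in> J2 \<or> b \<in> I2}"
      proof -
        obtain I1 J1 I2 J2 where c: "finite I1" "finite J1" "finite I2" "finite J2"
          "card I1 + card J1 \<le> n" "T - {(y, x)} \<subseteq> {(a, b). a \<in> I1 \<or> b \<in> J1}"
          "card I2 + card J2 \<le> n" "T - {(z, x)} \<subseteq> {(a, b). a \<in> I2 \<or> b \<in> J2}"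
          using crit[OF pq(1)] crit[OF pq(2)] unfolding eq by blast
        show thesis by (rule that[of J1 I1 J2 I2]) (use c in auto)
      qed
      have "\<not> p \<noteq> q"
      proof
        assume "p \<noteq> q"
        then have "y \<noteq> z" using eq by auto
        then obtain I J where IJ: "finite J" "finite I" "card J + card I \<le> n"
          "T\<inverse> \<subseteq> {(a, b). a \<in> J \<or> b \<in> I}"
          using koenig_share[of x y "T\<inverse>" z, OF _ _ _ c] pq eq by blast
        then have "T \<subseteq> {(a, b). a \<in> I \<or> b \<in> J}" by auto
        then show False using IJ less.prems(2) by (metis add.commute)
      qed
      then show "p = q" by simp
    qed
    moreover have "Suc n \<le> card T"
    proof (rule ccontr)
      assume "\<not> Suc n \<le> card T"
      then have "card (fst ` T) + card ({} :: 'b set) \<le> n"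
        using card_image_le[OF less.prems(1), of fst] by simp
      moreover have "T \<subseteq> {(a, b). a \<in> fst ` T \<or> b \<in> ({} :: 'b set)}" by force
      ultimately show False using less.prems by (metis finite.emptyI finite_imageI)
    qed
    then obtain M where "M \<subseteq> T" "card M = Suc n" by (rule obtain_subset_with_card_n)
    ultimately show ?thesis by (meson inj_on_subset)
  qed
qed

section \<open>Alternating cycles\<close>

text \<open>The pairs \<open>(a\<^sub>i, b\<^sub>i)\<close> encode the closed walk \<open>a\<^sub>1 b\<^sub>1 a\<^sub>2 b\<^sub>2 \<dots> a\<^sub>n b\<^sub>n a\<^sub>1\<close>,
  which is a cycle of length \<open>2n\<close> for \<open>n \<ge> 2\<close>.\<close>

definition bicycle :: "('a \<times> 'b) set \<Rightarrow> ('a \<times> 'b) list \<Rightarrow> bool" where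
  "bicycle E ps \<longleftrightarrow> ps \<noteq> [] \<and> distinct (map fst ps) \<and> distinct (map snd ps) \<and> set ps \<subseteq> E \<and>
     successively (\<lambda>p q. (fst q, snd p) \<in> E) ps \<and> (fst (hd ps), snd (last ps)) \<in> E"

lemma bicycle_rotate1:
  assumes "bicycle E ps"
  shows "bicycle E (rotate1 ps)"
proof (cases ps)
  case (Cons p qs)
  then show ?thesis using assms unfolding bicycle_def
    by (cases qs) (auto simp: successively_append_iff successively_Cons hd_append)
qed (use assms in simp)

lemma bicycle_rotate: "bicycle E ps \<Longrightarrow> bicycle E (rotate n ps)"
  by (induction n) (auto intro: bicycle_rotate1)

text \<open>The same cycle read backwards, starting at the last right vertex.\<close>

lemma bicycle_converse:
  assumes "bicycle E ps"
  shows "bicycle (E\<inverse>) (rev (map prod.swap ps))"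
  using assms unfolding bicycle_def
  by (auto simp: successively_rev successively_map rev_map[symmetric] hd_rev last_rev last_map
      list.map_sel comp_def)


text \<open>Induction on \<open>k\<close>: remove a vertex \<open>w\<close> joined to all of
  \<open>I\<close> together with an \<open>a\<close> that lies in a missing pair, if there is one.
  The budget of missing pairs then still suffices, and \<open>a\<close>, \<open>w\<close> can be
  spliced into the shorter cycle.\<close>

lemma bicycle_near_complete:
  fixes E :: "('a \<times> 'b) set"
  assumes "finite I" "card I = k" "finite W" "k \<le> card W" "2 \<le> k" "card (I \<times> W - E) + 2 \<le> k"
  shows "\<exists>ps. bicycle E ps \<and> length ps = k \<and> set ps \<subseteq> I \<times> W"
  using assms(5,1-4,6)
proof (induction k arbitrary: I W rule: dec_induct)
  case base
  then have "I \<times> W \<subseteq> E" by (auto simp: card_eq_0_iff)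
  moreover obtain a a' where "I = {a, a'}" "a \<noteq> a'" using base by (meson card_2_iff)
  moreover have "\<not> card W \<le> Suc 0" using base by simp
  then obtain b b' where "b \<in> W" "b' \<in> W" "b \<noteq> b'"
    using base(3) by (auto simp: card_le_Suc0_iff_eq)
  ultimately show ?case
    by (intro exI[of _ "[(a, b), (a', b')]"]) (auto simp: bicycle_def)
next
  \<comment> \<open>Here \<open>k\<close> is the smaller size: \<open>I\<close> has
    \<open>Suc k\<close> elements and at most \<open>k - 1\<close> pairs are missing.\<close>
  case (step k)
  have fin: "finite (I \<times> W - E)" using step.prems by simp
  obtain w where w: "w \<in> W" "\<And>a. a \<in> I \<Longrightarrow> (a, w) \<in> E"
  proof -
    have "card (snd ` (I \<times> W - E)) < card W"
      using card_image_le[OF fin, of snd] step.prems(4,5) by linarith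
    then have "\<not> W \<subseteq> snd ` (I \<times> W - E)"
      using card_mono[OF finite_imageI[OF fin], of W snd] by linarith
    then obtain w where w: "w \<in> W" "w \<notin> snd ` (I \<times> W - E)" by blast
    show thesis
    proof (rule that)
      show "(a, w) \<in> E" if "a \<in> I" for a using w that by force
    qed (fact w(1))
  qed
  obtain a where a: "a \<in> I" "card ((I - {a}) \<times> (W - {w}) - E) + 2 \<le> k"
  proof (cases "I \<times> W - E = {}")
    case True
    obtain a where "a \<in> I" using step.prems(2) by (metis card.empty equals0I nat.distinct(1))
    moreover have "(I - {a}) \<times> (W - {w}) - E = {}" using True by blast
    ultimately show ?thesis using that[of a] step.hyps by (metis card.empty add_0)
  next
    case False
    then obtain a b where ab: "(a, b) \<in> I \<times> W - E" by auto
    then have "(I - {a}) \<times> (W - {w}) - E \<subset> I \<times> W - E" by blast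
    then have "card ((I - {a}) \<times> (W - {w}) - E) < card (I \<times> W - E)"
      using fin by (intro psubset_card_mono)
    then show ?thesis using that[of a] ab step.prems(5) by auto
  qed
  obtain ps where ps: "bicycle E ps" "length ps = k" "set ps \<subseteq> (I - {a}) \<times> (W - {w})"
  proof -
    have "k \<le> card (W - {w})" using step.prems w(1) by simp
    then show ?thesis using step.IH[of "I - {a}" "W - {w}"] step.prems a that by auto
  qed
  have cs: "card (snd ` set ps) = k"
    using ps unfolding bicycle_def by (metis distinct_card length_map set_map)
  \<comment> \<open>At most \<open>k - 1\<close> pairs are missing, but the cycle has
    \<open>k\<close> right vertices.\<close>
  have "\<exists>p\<in>set ps. (a, snd p) \<in> E"
  proof (rule ccontr)
    assume "\<not> ?thesis"
    then have "Pair a ` snd ` set ps \<subseteq> I \<times> W - E" using ps(3) a(1) by auto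
    then have "card (Pair a ` snd ` set ps) \<le> card (I \<times> W - E)" using fin by (rule card_mono[rotated])
    then show False using cs step.prems(5) by (simp add: card_image inj_on_def)
  qed
  then obtain p where p: "p \<in> set ps" "(a, snd p) \<in> E" by blast
  obtain us vs where uv: "ps = us @ p # vs" using p by (meson split_list)
  \<comment> \<open>Rotate \<open>p\<close> to the end. Then \<open>a\<close> attaches to
    \<open>snd p\<close>, and \<open>w\<close> leads back to the start because it is joined to all
    of \<open>I\<close>.\<close>
  define rs where "rs = vs @ us @ [p]"
  have "rs = rotate (length (us @ [p])) ps"
    unfolding rs_def uv by (metis append.assoc append_Cons append_Nil rotate_append)
  then have rs: "bicycle E rs" using bicycle_rotate[OF ps(1)] by metis
  have set: "set rs = set ps" and len: "length rs = k" and ne: "rs \<noteq> []"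
    using ps(2) unfolding rs_def uv by auto
  have sub: "set rs \<subseteq> (I - {a}) \<times> (W - {w})" using set ps(3) by simp
  have "fst (hd rs) \<in> I" using sub ne hd_in_set[OF ne] by (metis DiffD1 mem_Times_iff subset_iff)
  then have "(fst (hd rs), w) \<in> E" using w(2) by simp
  moreover have "(a, w) \<in> E" using w(2) a(1) by simp
  moreover have "last rs = p" unfolding rs_def by simp
  moreover have "a \<notin> fst ` set rs" "w \<notin> snd ` set rs" using sub by auto
  ultimately have "bicycle E (rs @ [(a, w)])"
    using rs p ne unfolding bicycle_def by (auto simp: successively_append_iff)
  then show ?case using len sub a w
    by (intro exI[of _ "rs @ [(a, w)]"]) auto
qed

section \<open>Crossing sets of pairs\<close>

lemma card_Sigma_le:
  assumes "finite A" "\<And>x. x \<in> A \<Longrightarrow> finite (B x)" "\<And>x. x \<in> A \<Longrightarrow> card (B x) \<le> n"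
  shows "card (Sigma A B) \<le> card A * n"
  using assms sum_bounded_above[of A "\<lambda>x. card (B x)" n] by (simp add: card_SigmaI)

lemma card_le_sum:
  fixes f :: "'a \<Rightarrow> nat"
  assumes "\<And>x. x \<in> A \<Longrightarrow> f x \<noteq> 0"
  shows "card A \<le> sum f A"
proof -
  have "1 \<le> f x" if "x \<in> A" for x using assms[OF that] by simp
  then show ?thesis using sum_bounded_below[of A 1 f] by simp
qed

text \<open>The bipartite case in abstract form: \<open>T\<close> is the strong clique,
  \<open>E\<close> the edges between the two classes, both directed from left to right, and
  \<open>D\<close> is the maximum degree. A linking edge inside a class is impossible, so
  \<open>cross\<close> offers only two of the four ways to link.\<close>

locale crossing =
  fixes E T :: "('a \<times> 'b) set" and D :: nat
  assumes finite_E: "finite E"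
    and T_sub: "T \<subseteq> E"
    and cross: "(a, b) \<in> T \<Longrightarrow> (a', b') \<in> T \<Longrightarrow> (a, b') \<in> E \<or> (a', b) \<in> E"
    and deg_left: "card (E `` {a}) \<le> D"
    and deg_right: "card (E\<inverse> `` {b}) \<le> D"
begin

lemma crossing_converse: "crossing (E\<inverse>) (T\<inverse>) D"
  using finite_E T_sub cross deg_left deg_right by unfold_locales auto

lemma finite_T: "finite T" using finite_E T_sub finite_subset by blast

lemma finite_nbrs:
  "finite (E `` {a})" "finite (T `` {a})" "finite (E\<inverse> `` {b})" "finite (T\<inverse> `` {b})"
  using finite_E finite_T by auto

lemma T_deg_left: "card (T `` {a}) \<le> D"
  using deg_left[of a] card_mono[OF finite_nbrs(1), of "T `` {a}" a] T_sub by (meson Image_mono order_refl order_trans)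

lemma T_deg_right: "card (T\<inverse> `` {b}) \<le> D"
  using deg_right[of b] card_mono[OF finite_nbrs(3), of "T\<inverse> `` {b}" b] T_sub
  by (meson Image_mono converse_mono order_refl order_trans)

text \<open>Direct \<open>p\<close> to \<open>q\<close> if the right end of \<open>p\<close> is
  joined to the left end of \<open>q\<close>. A directed cycle on \<open>k\<close> matching edges is
  then an alternating cycle of length \<open>2 * k\<close>.\<close>

lemma matching_bicycle:
  assumes "M \<subseteq> T" "inj_on fst M" "inj_on snd M" "card M = Suc k" "3 \<le> k"
  shows "\<exists>ps. bicycle E ps \<and> length ps = k"
proof -
  let ?R = "\<lambda>p q. (fst q, snd p) \<in> E"
  have "?R p q \<or> ?R q p" if "p \<in> M" "q \<in> M" for p q
    using cross[of "fst p" "snd p" "fst q" "snd q"] that assms(1) by auto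
  then obtain ps where ps: "distinct ps" "set ps \<subseteq> M" "successively ?R ps"
    and alt: "length ps = k \<and> ?R (last ps) (hd ps) \<or> length ps = Suc k \<and> ?R (hd ps) (last ps)"
    using near_hamiltonian_cycle[of M k ?R] assms(4,5) by auto
  have dist: "distinct (map fst ps)" "distinct (map snd ps)"
    using ps(1,2) assms(2,3) by (auto simp: distinct_map intro: inj_on_subset)
  have sub: "set ps \<subseteq> T" using ps(2) assms(1) by blast
  from alt show ?thesis
  proof
    assume "length ps = k \<and> ?R (last ps) (hd ps)"
    then show ?thesis using ps(3) dist sub T_sub assms(5)
      by (intro exI[of _ ps]) (auto simp: bicycle_def)
  next
    assume len: "length ps = Suc k \<and> ?R (hd ps) (last ps)"
    \<comment> \<open>Drop the first left end and the last right end. The other \<open>2 * k\<close>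
      vertices lie on a cycle made of the \<open>k\<close> path arcs, the \<open>k - 1\<close> inner
      matching edges and the arc from first to last. It starts on the right side, so it is a cycle
      of the converse.\<close>
    define zs where "zs = zip (map snd (butlast ps)) (map fst (tl ps))"
    have "ps \<noteq> []" using len by auto
    have lz: "length zs = k" using len unfolding zs_def by simp
    have nz: "zs ! i = (snd (ps ! i), fst (ps ! Suc i))" if "i < k" for i
      using len that unfolding zs_def by (simp add: nth_butlast nth_tl)
    have R: "?R (ps ! i) (ps ! Suc i)" if "i < k" for i
      using ps(3) len that by (simp add: successively_conv_nth)
    have T: "ps ! i \<in> T" if "i < Suc k" for i 
      using sub len that nth_mem[of i ps] by auto
    have "map fst zs = butlast (map snd ps)" "map snd zs = tl (map fst ps)"
      using len unfolding zs_def by (simp_all add: map_butlast map_tl)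
    then have "distinct (map fst zs)" "distinct (map snd zs)"
      using dist by (simp_all add: distinct_butlast distinct_tl)
    moreover have "set zs \<subseteq> E\<inverse>" using nz R lz by (auto simp: set_conv_nth)
    moreover have "successively (\<lambda>p q. (fst q, snd p) \<in> E\<inverse>) zs"
      unfolding successively_conv_nth
    proof (intro allI impI)
      fix i assume "Suc i < length zs"
      then show "(fst (zs ! Suc i), snd (zs ! i)) \<in> E\<inverse>"
        using nz[of i] nz[of "Suc i"] T[of "Suc i"] T_sub lz by auto
    qed
    moreover have "zs \<noteq> []" using lz assms(5) by auto
    moreover have "(fst (hd zs), snd (last zs)) \<in> E\<inverse>"
    proof -
      have "hd zs = zs ! 0" "last zs = zs ! (k - 1)" "hd ps = ps ! 0" "last ps = ps ! k"
        using lz len \<open>zs \<noteq> []\<close> by (auto simp: hd_conv_nth last_conv_nth \<open>ps \<noteq> []\<close>)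
      then show ?thesis using nz[of 0] nz[of "k - 1"] len assms(5) by simp
    qed
    ultimately have "bicycle (E\<inverse>) zs" by (simp add: bicycle_def)
    then show ?thesis using bicycle_converse[of "E\<inverse>" zs] lz
      by (intro exI[of _ "rev (map prod.swap zs)"]) simp
  qed
qed

text \<open>Let \<open>a\<close> have maximal \<open>T\<close>-degree, \<open>N\<close> be its
  \<open>T\<close>-neighbourhood and \<open>P\<close> the set of vertices joined to all of
  \<open>N\<close>. A \<open>T\<close>-edge starting outside \<open>P\<close> is linked to some edge
  at \<open>a\<close> and must end in \<open>E\<close>
  {a}\<open>. So\<close>T\<open>splits into edges starting in\<close>P\<open>, other edges into\<close>N\<open>, and edges into\<close>E
  \<open>{a} - N\<close>, and the three bounds add up to \<open>D * D\<close>.\<close>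

lemma card_le_square: "card T \<le> D * D"
proof (cases "T = {}")
  case False
  let ?f = "\<lambda>a. card (T `` {a})"
  have "finite (?f ` Domain T)" "?f ` Domain T \<noteq> {}" using False finite_T by (auto simp: finite_Domain)
  then have "Max (?f ` Domain T) \<in> ?f ` Domain T" by (rule Max_in)
  then obtain a where a: "Max (?f ` Domain T) = ?f a" "a \<in> Domain T" by (rule imageE)
  have max: "?f a' \<le> ?f a" for a'
  proof (cases "a' \<in> Domain T")
    case True
    then show ?thesis using a(1) Max_ge[OF \<open>finite (?f ` Domain T)\<close>, of "?f a'"] by simp
  next
    case False
    then have "T `` {a'} = {}" by blast
    then show ?thesis by simp
  qed
  define N where "N = T `` {a}"
  define P where "P = {a'. N \<subseteq> E `` {a'}}"
  have N: "finite N" "card N \<le> D" "N \<noteq> {}" "N \<subseteq> E `` {a}"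
    unfolding N_def using a finite_nbrs T_deg_left T_sub by auto
  have Psub: "P \<subseteq> E\<inverse> `` {b}" if "b \<in> N" for b using that unfolding P_def by auto
  obtain b where "b \<in> N" using N by blast
  have P: "finite P" "card P \<le> D"
    using Psub[OF \<open>b \<in> N\<close>] finite_nbrs(3)[of b] deg_right[of b] card_mono[of "E\<inverse> `` {b}" P]
    by (auto intro: finite_subset)
  let ?T1 = "SIGMA a':P. T `` {a'}"
  let ?T2 = "SIGMA b':N. E\<inverse> `` {b'} - P"
  let ?T3 = "SIGMA b':E `` {a} - N. T\<inverse> `` {b'}"
  have fin: "finite ?T1" "finite ?T2" "finite ?T3"
    using finite_E finite_T finite_nbrs N P by (auto intro!: finite_SigmaI)
  have "T \<subseteq> ?T1 \<union> ?T2\<inverse> \<union> ?T3\<inverse>"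
  proof
    fix t assume t: "t \<in> T"
    obtain a' b' where eq: "t = (a', b')" by fastforce
    have "b' \<in> E `` {a}" if "a' \<notin> P"
    proof -
      obtain b where "(a, b) \<in> T" "(a', b) \<notin> E" using \<open>a' \<notin> P\<close> unfolding P_def N_def by auto
      then show ?thesis using cross[of a b a' b'] t eq by auto
    qed
    then show "t \<in> ?T1 \<union> ?T2\<inverse> \<union> ?T3\<inverse>" using t eq T_sub by auto
  qed
  then have "card T \<le> card (?T1 \<union> ?T2\<inverse> \<union> ?T3\<inverse>)" using fin by (intro card_mono) auto
  also have "\<dots> \<le> card ?T1 + card (?T2\<inverse>) + card (?T3\<inverse>)"
    by (meson add_mono_thms_linordered_semiring(3) card_Un_le order_trans)
  also have "\<dots> = card ?T1 + card ?T2 + card ?T3" by (simp only: card_inverse)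
  also have "\<dots> \<le> card P * card N + card N * (D - card P) + (D - card N) * D"
  proof (intro add_mono)
    show "card ?T1 \<le> card P * card N"
      using P finite_nbrs max unfolding N_def by (intro card_Sigma_le) auto
    have "card (E\<inverse> `` {b'} - P) \<le> D - card P" if "b' \<in> N" for b'
      using card_Diff_subset[OF P(1) Psub[OF that]] deg_right[of b'] by simp
    then show "card ?T2 \<le> card N * (D - card P)"
      using N finite_nbrs by (intro card_Sigma_le) auto
    have "card ?T3 \<le> card (E `` {a} - N) * D"
      using finite_nbrs T_deg_right by (intro card_Sigma_le) auto
    also have "\<dots> \<le> (D - card N) * D"
      using card_Diff_subset[OF N(1,4)] deg_left[of a] by (intro mult_right_mono) auto
    finally show "card ?T3 \<le> (D - card N) * D" .
  qed
  also have "\<dots> = D * D"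
  proof -
    have "card P * card N + card N * (D - card P) = card N * (card P + (D - card P))"
      by (simp only: add_mult_distrib2 mult.commute)
    also have "\<dots> + (D - card N) * D = (card N + (D - card N)) * D"
      using P(2) by (simp add: add_mult_distrib)
    also have "\<dots> = D * D" using N(2) by simp
    finally show ?thesis .
  qed
  finally show ?thesis .
qed simp

section \<open>Degree deficits in covers of size \<open>k\<close>\<close>

lemma card_cover:
  assumes "finite I" "finite J" "T \<subseteq> {(a, b). a \<in> I \<or> b \<in> J}"
  shows "card T + card (T \<inter> I \<times> J) = (\<Sum>a\<in>I. card (T `` {a})) + (\<Sum>b\<in>J. card (T\<inverse> `` {b}))"
proof -
  let ?A = "SIGMA a:I. T `` {a}" and ?B = "(SIGMA b:J. T\<inverse> `` {b})\<inverse>"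
  have "?A \<union> ?B = T" "?A \<inter> ?B = T \<inter> I \<times> J" using assms(3) by auto
  moreover have "finite ?A" "finite ?B" using assms(1,2) finite_nbrs by auto
  ultimately have "card T + card (T \<inter> I \<times> J) = card ?A + card ?B" using card_Un_Int by metis
  also have "card ?A = (\<Sum>a\<in>I. card (T `` {a}))"
    by (rule card_SigmaI) (use assms finite_nbrs in auto)
  also have "card ?B = (\<Sum>b\<in>J. card (T\<inverse> `` {b}))"
    unfolding card_inverse by (rule card_SigmaI) (use assms finite_nbrs in auto)
  finally show ?thesis .
qed

text \<open>An exact balance: for a cover of size \<open>k\<close> and \<open>T\<close> above the
  claimed bound, it leaves at most \<open>k - 2\<close> for the doubly covered edges and all
  deficits from degree \<open>D\<close> together.\<close>

lemma deficiency:
  assumes "finite I" "finite J" "T \<subseteq> {(a, b). a \<in> I \<or> b \<in> J}"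
  shows "card T + card (T \<inter> I \<times> J) + (\<Sum>a\<in>I. D - card (T `` {a}))
    + (\<Sum>b\<in>J. D - card (T\<inverse> `` {b})) = (card I + card J) * D"
proof -
  have "(\<Sum>a\<in>I. card (T `` {a})) + (\<Sum>a\<in>I. D - card (T `` {a})) = card I * D"
    using T_deg_left by (simp flip: sum.distrib)
  moreover have "(\<Sum>b\<in>J. card (T\<inverse> `` {b})) + (\<Sum>b\<in>J. D - card (T\<inverse> `` {b})) = card J * D"
    using T_deg_right by (simp flip: sum.distrib)
  ultimately show ?thesis using card_cover[OF assms] by (simp add: algebra_simps)
qed

lemma full_eq:
  assumes "card (T `` {a}) = D"
  shows "E `` {a} = T `` {a}"
proof -
  have "T `` {a} \<subseteq> E `` {a}" using T_sub by auto
  then show ?thesis using assms deg_left[of a] finite_nbrs(1)[of a] by (metis card_seteq)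
qed

text \<open>A \<open>T\<close>-neighbour \<open>b'\<close> of \<open>a'\<close> outside
  \<open>T\<close>
  {a}\<open>is not joined to\<close>a\<open>, whose neighbours are used up. Then\<close>cross\<open>joins\<close>a'\<open>to all of\<close>T
  \<open>{a}\<close> as well as to \<open>b'\<close>, which are \<open>D + 1\<close>
  neighbours.\<close>

lemma full_absorbs:
  assumes "card (T `` {a}) = D"
  shows "T `` {a'} \<subseteq> T `` {a}"
proof (rule ccontr)
  assume "\<not> ?thesis"
  then obtain b' where b': "(a', b') \<in> T" "(a, b') \<notin> T" by auto
  then have "(a, b') \<notin> E" using full_eq[OF assms] by auto
  then have "insert b' (T `` {a}) \<subseteq> E `` {a'}" using cross b' T_sub by blast
  then have "card (insert b' (T `` {a})) \<le> D"
    using card_mono[OF finite_nbrs(1), of _ a'] deg_left[of a'] le_trans by blast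
  then show False using b' assms finite_nbrs(2)[of a] by simp
qed

text \<open>Every vertex of the cover outside the set \<open>F\<close> of full vertices costs at
  least one unit of the budget \<open>k - 2\<close>. Hence \<open>F\<close> is nonempty, any vertex
  in \<open>J\<close> would overdraw the budget, and \<open>T\<close> is an almost complete graph
  between \<open>I\<close> and the common neighbourhood \<open>W\<close> of
  \<open>F\<close>.\<close>

lemma cover_bound_one_sided:
  assumes IJ: "finite I" "finite J" "T \<subseteq> {(a, b). a \<in> I \<or> b \<in> J}" "card I + card J = k"
    and k: "2 \<le> k" "k \<le> D"
    and big: "k * D < card T + (k - 1)"
    and J: "\<And>b. b \<in> J \<Longrightarrow> card (T\<inverse> `` {b}) < D"
  shows "\<exists>ps. bicycle E ps \<and> length ps = k"
proof -
  let ?x = "\<lambda>a. D - card (T `` {a})" and ?y = "\<lambda>b. D - card (T\<inverse> `` {b})"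
  let ?inner = "card (T \<inter> I \<times> J)"
  have def: "sum ?x I + sum ?y J + ?inner + 2 \<le> k"
    using deficiency[OF IJ(1-3)] IJ(4) big by simp
  define F where "F = {a \<in> I. card (T `` {a}) = D}"
  have F: "F \<subseteq> I" "finite F" using IJ(1) unfolding F_def by auto
  have "card (I - F) \<le> sum ?x (I - F)"
  proof (rule card_le_sum)
    show "?x a \<noteq> 0" if "a \<in> I - F" for a using that T_deg_left[of a] unfolding F_def by auto
  qed
  also have "\<dots> \<le> sum ?x I" using IJ(1) by (intro sum_mono2) auto
  finally have xF: "card I - card F \<le> sum ?x I" using F by (simp add: card_Diff_subset)
  have FI: "card F \<le> card I" using F IJ(1) card_mono by blast
  have yJ: "card B \<le> sum ?y B" if "B \<subseteq> J" for B
    using J that by (intro card_le_sum) (force simp: subset_iff)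
  have "F \<noteq> {}" using xF yJ[of J] def IJ(4) by auto
  then obtain a0 where a0: "a0 \<in> F" by blast
  define W where "W = T `` {a0}"
  have fullW: "T `` {a} = W" if "a \<in> F" for a
    using full_absorbs that a0 unfolding F_def W_def by blast
  have W: "finite W" "card W = D" "E `` {a0} = W" "\<And>a. T `` {a} \<subseteq> W"
    using a0 finite_nbrs full_eq full_absorbs unfolding F_def W_def by auto
  have "J = {}"
  proof (rule ccontr)
    assume "J \<noteq> {}"
    then obtain b where b: "b \<in> J" by blast
    show False
    proof (cases "b \<in> W")
      case True
      \<comment> \<open>The doubly covered edges at \<open>b\<close> make up for the vertices of
        \<open>F\<close>, so the total cost is at least \<open>k\<close>.\<close>
      then have "F \<times> {b} \<subseteq> T \<inter> I \<times> J" using fullW F b by blast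
      then have "card (F \<times> {b}) \<le> ?inner" using finite_T by (intro card_mono) auto
      then have "card F \<le> ?inner" by (simp add: card_cartesian_product)
      then show False using xF yJ[of J] def IJ(4) FI by simp
    next
      case False
      obtain w where w: "w \<in> W" using W(2) k by (metis card.empty ex_in_conv le_zero_eq not_numeral_le_zero le_trans)
      \<comment> \<open>As \<open>a0\<close> is not joined to \<open>b\<close>, each edge at
        \<open>b\<close> is linked to \<open>(a0, w)\<close> through \<open>w\<close>. So
        \<open>b\<close> has a deficit of at least \<open>card F\<close>, and the total cost is at
        least \<open>k - 1\<close>.\<close>
      have "T\<inverse> `` {b} \<union> F \<subseteq> E\<inverse> `` {w}"
        using cross[of a0 w _ b] False w W(3) fullW T_sub unfolding W_def by blast
      then have "card (T\<inverse> `` {b} \<union> F) \<le> D"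
        using card_mono[OF finite_nbrs(3), of _ w] deg_right[of w] le_trans by blast
      moreover have "T\<inverse> `` {b} \<inter> F = {}" using fullW False by blast
      ultimately have "card F \<le> ?y b" using F(2) finite_nbrs(4) by (simp add: card_Un_disjoint)
      moreover have "sum ?y J = ?y b + sum ?y (J - {b})" using IJ(2) b by (simp add: sum.remove)
      moreover have "card (J - {b}) = card J - 1" "card J \<noteq> 0" using IJ(2) b by auto
      ultimately show False using xF yJ[of "J - {b}"] def IJ(4) FI by auto
    qed
  qed
  then have "T \<subseteq> I \<times> W" using IJ(3) W(4) by auto
  then have "card (I \<times> W - T) = k * D - card T"
    using finite_T \<open>J = {}\<close> IJ(4) W(2) by (simp add: card_Diff_subset card_cartesian_product)
  moreover have "card (I \<times> W - E) \<le> card (I \<times> W - T)" using IJ(1) W(1) T_sub by (intro card_mono) auto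
  ultimately have "card (I \<times> W - E) + 2 \<le> k" using big k by linarith
  then show ?thesis
    using bicycle_near_complete[of I k W E] IJ \<open>J = {}\<close> W k by auto
qed

text \<open>If one side of the cover has no full vertex, the one-sided case applies, if necessary to
  the converse. Otherwise absorption puts every pair of full vertices from opposite sides into
  \<open>T\<close>, and these doubly covered edges exceed the budget.\<close>

lemma cover_bound:
  assumes IJ: "finite I" "finite J" "T \<subseteq> {(a, b). a \<in> I \<or> b \<in> J}" "card I + card J = k"
    and k: "2 \<le> k" "k \<le> D"
    and big: "k * D < card T + (k - 1)"
  shows "\<exists>ps. bicycle E ps \<and> length ps = k"
proof -
  interpret conv: crossing "E\<inverse>" "T\<inverse>" D by (rule crossing_converse)
  define F where "F = {a \<in> I. card (T `` {a}) = D}"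
  define H where "H = {b \<in> J. card (T\<inverse> `` {b}) = D}"
  consider "H = {}" | "F = {}" | "F \<noteq> {}" "H \<noteq> {}" by blast
  then show ?thesis
  proof cases
    case 1
    then have "card (T\<inverse> `` {b}) < D" if "b \<in> J" for b
      using that T_deg_right[of b] unfolding H_def by (auto simp: order_less_le)
    then show ?thesis by (rule cover_bound_one_sided[OF IJ k big])
  next
    case 2
    then have "card ((T\<inverse>)\<inverse> `` {a}) < D" if "a \<in> I" for a
      using that T_deg_left[of a] unfolding F_def by (auto simp: order_less_le)
    moreover have "T\<inverse> \<subseteq> {(b, a). b \<in> J \<or> a \<in> I}" using IJ(3) by auto
    moreover have "k * D < card (T\<inverse>) + (k - 1)" using big by (simp only: card_inverse)
    ultimately obtain ps where "bicycle (E\<inverse>) ps" "length ps = k"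
      using conv.cover_bound_one_sided[of J I k] IJ k by (auto simp: add.commute)
    then show ?thesis using bicycle_converse[of "E\<inverse>" ps]
      by (intro exI[of _ "rev (map prod.swap ps)"]) simp
  next
    case 3
    let ?x = "\<lambda>a. D - card (T `` {a})" and ?y = "\<lambda>b. D - card (T\<inverse> `` {b})"
    have fin: "finite F" "finite H" "F \<subseteq> I" "H \<subseteq> J" using IJ unfolding F_def H_def by auto
    have "F \<times> H \<subseteq> T \<inter> I \<times> J"
    proof (rule subrelI)
      fix a b assume "(a, b) \<in> F \<times> H"
      then have ab: "a \<in> F" "b \<in> H" by auto
      then have "card (T\<inverse> `` {b}) \<noteq> 0" using k unfolding H_def by auto
      then have "T\<inverse> `` {b} \<noteq> {}" by (metis card.empty)
      then obtain a' where "(a', b) \<in> T" by blast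
      then have "(a, b) \<in> T" using full_absorbs[of a a'] ab unfolding F_def by auto
      then show "(a, b) \<in> T \<inter> I \<times> J" using ab fin by auto
    qed
    then have "card (F \<times> H) \<le> card (T \<inter> I \<times> J)" using finite_T by (intro card_mono) auto
    then have inner: "card F * card H \<le> card (T \<inter> I \<times> J)" by (simp add: card_cartesian_product)
    have "card (I - F) \<le> sum ?x (I - F)"
    proof (rule card_le_sum)
      show "?x a \<noteq> 0" if "a \<in> I - F" for a using that T_deg_left[of a] unfolding F_def by auto
    qed
    also have "\<dots> \<le> sum ?x I" using IJ(1) by (intro sum_mono2) auto
    finally have xF: "card I - card F \<le> sum ?x I" using fin by (simp add: card_Diff_subset)
    have "card (J - H) \<le> sum ?y (J - H)"
    proof (rule card_le_sum)
      show "?y b \<noteq> 0" if "b \<in> J - H" for b using that T_deg_right[of b] unfolding H_def by auto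
    qed
    also have "\<dots> \<le> sum ?y J" using IJ(2) by (intro sum_mono2) auto
    finally have yH: "card J - card H \<le> sum ?y J" using fin by (simp add: card_Diff_subset)
    obtain f h where fh: "card F = Suc f" "card H = Suc h"
      using 3 fin by (metis card_eq_0_iff not0_implies_Suc)
    \<comment> \<open>From \<open>(f + 1) * (h + 1) \<ge> f + h + 1\<close>; with the at least
      \<open>k - f - h - 2\<close> units for vertices that are not full, the cost is at least
      \<open>k - 1\<close>.\<close>
    then have "f + h + 1 \<le> card (T \<inter> I \<times> J)" using inner by simp
    moreover have "sum ?x I + sum ?y J + card (T \<inter> I \<times> J) + 2 \<le> k"
      using deficiency[OF IJ(1-3)] IJ(4) big by simp
    moreover have "card F \<le> card I" "card H \<le> card J" using fin IJ card_mono by blast+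
    ultimately show ?thesis using xF yH fh IJ(4) by linarith
  qed
qed

text \<open>The six edges form a 6-cycle, on which any two of \<open>b1, b2, b3\<close> have a
  common neighbour, and so do any two of \<open>a1, a2, a3\<close>. A further edge linked to all
  three matching edges would close a 4-cycle.\<close>

lemma three_matching_oriented:
  assumes no4: "\<And>a a' b b'. (a, b) \<in> E \<Longrightarrow> (a, b') \<in> E \<Longrightarrow> (a', b) \<in> E \<Longrightarrow> (a', b') \<in> E \<Longrightarrow>
      a = a' \<or> b = b'"
    and T: "(a1, b1) \<in> T" "(a2, b2) \<in> T" "(a3, b3) \<in> T"
    and ne: "a1 \<noteq> a2" "a2 \<noteq> a3" "a1 \<noteq> a3" "b1 \<noteq> b2" "b2 \<noteq> b3" "b1 \<noteq> b3"
    and c: "(a2, b1) \<in> E" "(a3, b2) \<in> E" "(a1, b3) \<in> E"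
  shows "T \<subseteq> {(a1, b1), (a2, b2), (a3, b3)}"
proof (rule subrelI)
  fix a b assume t: "(a, b) \<in> T"
  have e: "(a1, b1) \<in> E" "(a2, b2) \<in> E" "(a3, b3) \<in> E" "(a, b) \<in> E" using T t T_sub by auto
  have "(a, b1) \<in> E \<or> (a1, b) \<in> E" "(a, b2) \<in> E \<or> (a2, b) \<in> E" "(a, b3) \<in> E \<or> (a3, b) \<in> E"
    using cross T t by blast+
  then have "a = a1 \<and> b = b1 \<or> a = a2 \<and> b = b2 \<or> a = a3 \<and> b = b3"
    using e ne c no4 by metis
  then show "(a, b) \<in> {(a1, b1), (a2, b2), (a3, b3)}" by blast
qed

text \<open>This replaces \<open>matching_bicycle\<close> for \<open>k = 2\<close>. Without 4-cycles
  each pair of matching edges is linked in one direction only, and a transitive orientation of the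
  three pairs contains a 4-cycle. So the orientation is cyclic.\<close>

lemma three_matching:
  assumes no: "\<nexists>ps. bicycle E ps \<and> length ps = 2"
    and M: "M \<subseteq> T" "inj_on fst M" "inj_on snd M" "card M = 3"
  shows "card T \<le> 3"
proof -
  have no4: "a = a' \<or> b = b'"
    if "(a, b) \<in> E" "(a, b') \<in> E" "(a', b) \<in> E" "(a', b') \<in> E" for a a' b b'
  proof (rule ccontr)
    assume "\<not> ?thesis"
    then have "bicycle E [(a, b), (a', b')]" using that by (auto simp: bicycle_def)
    then show False using no by force
  qed
  obtain p1 p2 p3 where p: "M = {p1, p2, p3}" "p1 \<noteq> p2" "p2 \<noteq> p3" "p1 \<noteq> p3"
    using M(4) by (metis card_3_iff)
  obtain a1 b1 a2 b2 a3 b3 where eq: "p1 = (a1, b1)" "p2 = (a2, b2)" "p3 = (a3, b3)"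
    by (cases p1, cases p2, cases p3) blast
  have T: "(a1, b1) \<in> T" "(a2, b2) \<in> T" "(a3, b3) \<in> T" using M(1) unfolding p(1) eq by auto
  have inj: "fst q \<noteq> fst r" "snd q \<noteq> snd r" if "q \<in> M" "r \<in> M" "q \<noteq> r" for q r
    using that M(2,3) by (auto dest: inj_onD)
  have ne: "a1 \<noteq> a2" "a2 \<noteq> a3" "a1 \<noteq> a3" "b1 \<noteq> b2" "b2 \<noteq> b3" "b1 \<noteq> b3"
    using inj[of p1 p2] inj[of p2 p3] inj[of p1 p3] p eq by simp_all
  have e: "(a1, b1) \<in> E" "(a2, b2) \<in> E" "(a3, b3) \<in> E" using T T_sub by auto
  have "(a1, b2) \<in> E \<or> (a2, b1) \<in> E" "(a2, b3) \<in> E \<or> (a3, b2) \<in> E" "(a1, b3) \<in> E \<or> (a3, b1) \<in> E"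
    using cross T by blast+
  then consider "(a2, b1) \<in> E" "(a3, b2) \<in> E" "(a1, b3) \<in> E"
    | "(a1, b2) \<in> E" "(a3, b1) \<in> E" "(a2, b3) \<in> E"
    using e ne no4 by metis
  then have "T \<subseteq> {(a1, b1), (a2, b2), (a3, b3)}"
  proof cases
    case 1
    then show ?thesis using three_matching_oriented[OF no4 T ne] by blast
  next
    case 2
    then show ?thesis using three_matching_oriented[OF no4 T(2,1,3)] ne by blast
  qed
  then have "card T \<le> card {(a1, b1), (a2, b2), (a3, b3)}" by (intro card_mono) auto
  also have "\<dots> \<le> 3" by (simp add: card_insert_if)
  finally show ?thesis .
qed

lemma crossing_bound:
  assumes k: "2 \<le> k" and D: "1 \<le> D" and no: "\<nexists>ps. bicycle E ps \<and> length ps = k"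
  shows "card T + (k - 1) \<le> k * D"
proof (cases "k \<le> D")
  case False
  \<comment> \<open>For \<open>D < k\<close> the bound \<open>D * D\<close> is enough:
    \<open>D * D + D + m \<le> (D + 1 + m) * D\<close>.\<close>
  then obtain m where "k = Suc (D + m)" using less_imp_Suc_add[of D k] by auto
  moreover have "m \<le> m * D" using D by simp
  ultimately have "card T + m \<le> D * D + m * D"
    using add_mono[OF card_le_square, of m "m * D"] by blast
  then show ?thesis using \<open>k = Suc (D + m)\<close> by (simp add: algebra_simps)
next
  case True
  show ?thesis
  proof (cases "\<exists>I J. finite I \<and> finite J \<and> card I + card J \<le> k \<and> T \<subseteq> {(a, b). a \<in> I \<or> b \<in> J}")
    case True
    then obtain I J where IJ: "finite I" "finite J" "card I + card J \<le> k"
      "T \<subseteq> {(a, b). a \<in> I \<or> b \<in> J}" by blast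
    show ?thesis
    proof (cases "card I + card J = k")
      case True
      have "\<not> k * D < card T + (k - 1)"
        using cover_bound[OF IJ(1,2,4) True k \<open>k \<le> D\<close>] no by blast
      then show ?thesis by simp
    next
      case False
      \<comment> \<open>A cover with fewer than \<open>k\<close> vertices suffices because
        \<open>k - 1 \<le> D\<close>.\<close>
      have "card T \<le> (card I + card J) * D" using deficiency[OF IJ(1,2,4)] by simp
      also have "\<dots> \<le> (k - 1) * D" using IJ(3) False by (intro mult_right_mono) auto
      also have "\<dots> + (k - 1) \<le> k * D"
        using \<open>k \<le> D\<close> k by (cases k) auto
      finally show ?thesis by simp
    qed
  next
    case False
    then obtain M where M: "M \<subseteq> T" "inj_on fst M" "inj_on snd M" "card M = Suc k"
      using koenig[OF finite_T False] by blast
    show ?thesis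
    proof (cases "k = 2")
      case True
      then have "card T \<le> 3" using three_matching[of M] no M by simp
      then show ?thesis using True \<open>k \<le> D\<close> by simp
    next
      case False
      then show ?thesis using matching_bicycle[OF M] no k by auto
    qed
  qed
qed

end

section \<open>Triangles of linking edges\<close>

locale linked_edges =
  fixes adj s :: "'a \<Rightarrow> 'a \<Rightarrow> bool"
  assumes adj_sym: "adj u v \<Longrightarrow> adj v u"
    and adj_irrefl: "\<not> adj u u"
    and s_sym: "s u v \<Longrightarrow> s v u"
    and s_adj: "s u v \<Longrightarrow> adj u v"
    and linked: "s a b \<Longrightarrow> s c d \<Longrightarrow> distinct [a, b, c, d] \<Longrightarrow>
      adj a c \<or> adj a d \<or> adj b c \<or> adj b d"
    and no5: "adj a b \<Longrightarrow> adj b c \<Longrightarrow> adj c d \<Longrightarrow> adj d e \<Longrightarrow> adj e a \<Longrightarrow>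
      distinct [a, b, c, d, e] \<Longrightarrow> False"
begin

text \<open>The case distinction concerns triangles of this subgraph only; the whole of
  \<open>adj\<close> may fail to be bipartite even when \<open>link\<close> has no triangle.\<close>

definition link :: "'a \<Rightarrow> 'a \<Rightarrow> bool" where
  "link u v \<longleftrightarrow> s u v \<or> adj u v \<and> (\<exists>a b. s u a \<and> s v b \<and> distinct [u, a, v, b])"

lemma link_sym: "link u v \<Longrightarrow> link v u"
  unfolding link_def using adj_sym s_sym by (metis distinct_length_2_or_more distinct_singleton)

lemma link_adj: "link u v \<Longrightarrow> adj u v"
  unfolding link_def using s_adj by blast

lemma s_link: "s u v \<Longrightarrow> link u v"
  unfolding link_def by blast

lemma link_s: "link u v \<Longrightarrow> \<exists>w. s u w"
  unfolding link_def by blast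

definition triangle :: "'a \<Rightarrow> 'a \<Rightarrow> 'a \<Rightarrow> bool" where
  "triangle x y z \<longleftrightarrow> adj x y \<and> adj y z \<and> adj x z"

lemma triangleD:
  assumes "triangle x y z"
  shows "adj x y" "adj y x" "adj y z" "adj z y" "adj x z" "adj z x" "x \<noteq> y" "y \<noteq> z" "x \<noteq> z"
  using assms adj_sym adj_irrefl unfolding triangle_def by blast+

lemma triangle_perm:
  assumes "triangle x y z"
  shows "triangle y x z" "triangle x z y" "triangle z y x" "triangle y z x" "triangle z x y"
  using assms adj_sym unfolding triangle_def by blast+

section \<open>Clique edges disjoint from a triangle\<close>

definition sees_two :: "'a \<Rightarrow> 'a \<Rightarrow> 'a \<Rightarrow> bool" where
  "sees_two x y z \<longleftrightarrow> (\<forall>u v. s u v \<longrightarrow> u \<notin> {x, y, z} \<longrightarrow> v \<notin> {x, y, z} \<longrightarrow>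
     (adj x u \<or> adj x v) \<and> (adj y u \<or> adj y v) \<or> (adj y u \<or> adj y v) \<and> (adj z u \<or> adj z v) \<or>
     (adj x u \<or> adj x v) \<and> (adj z u \<or> adj z v))"

lemma sees_two_perm:
  assumes "sees_two x y z"
  shows "sees_two y x z" "sees_two x z y" "sees_two z y x" "sees_two y z x" "sees_two z x y"
  using assms unfolding sees_two_def by blast+

text \<open>If \<open>u\<close> and \<open>u'\<close> differ, each way for the edges
  \<open>u v\<close> and \<open>u' v'\<close> to meet or be linked closes a 5-cycle through
  \<open>x\<close>.\<close>

lemma hubs_same:
  assumes t: "triangle x y z" and u: "u \<notin> {x, y, z}" "adj u x" "adj u y" "s u v" "v \<notin> {x, y, z}"
    and u': "u' \<notin> {x, y, z}" "adj u' x" "adj u' y" "s u' v'" "v' \<notin> {x, y, z}"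
  shows "u = u'"
proof (rule ccontr)
  assume ne: "u \<noteq> u'"
  note sym = triangleD[OF t] adj_sym[OF u(2)] adj_sym[OF u(3)] adj_sym[OF u'(2)] adj_sym[OF u'(3)]
    s_adj[OF u(4)] s_adj[OF u'(4)] adj_sym[OF s_adj[OF u(4)]] adj_sym[OF s_adj[OF u'(4)]]
  have ir: "u \<noteq> v" "u' \<noteq> v'" using sym adj_irrefl by blast+
  have nuu: "\<not> adj u u'"
  proof
    assume "adj u u'"
    then show False using no5[of x u u' y z] sym u u' ne by auto
  qed
  then have ne2: "v \<noteq> u'" "v' \<noteq> u" using sym by auto
  have nvu: "\<not> adj v u'"
  proof
    assume "adj v u'"
    then show False using no5[of x u v u' y] sym u u' ne ne2 ir by auto
  qed
  then have "v \<noteq> v'" using sym by auto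
  then consider "adj u v'" | "adj v v'"
    using linked[OF u(4) u'(4)] nuu nvu ne ne2 ir by auto
  then show False
  proof cases
    case 1
    then show False using no5[of x u v' u' y] sym u u' ne ne2 ir by auto
  next
    case 2
    then show False using no5[of x u v v' u'] sym u u' ne ne2 ir \<open>v \<noteq> v'\<close> by auto
  qed
qed

text \<open>Otherwise \<open>u x z u' y\<close> is a 5-cycle.\<close>

lemma hubs_diff:
  assumes t: "triangle x y z" and u: "u \<notin> {x, y, z}" "adj u x" "adj u y"
    and u': "u' \<notin> {x, y, z}" "adj u' y" "adj u' z"
  shows "u = u'"
proof (rule ccontr)
  assume ne: "u \<noteq> u'"
  show False
    using no5[of u x z u' y] triangleD[OF t] u u' ne adj_sym[OF u(3)] adj_sym[OF u'(3)] by auto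
qed

lemma hubs_eq:
  assumes t: "triangle x y z"
    and u: "u \<notin> {x, y, z}" "adj u x \<and> adj u y \<or> adj u y \<and> adj u z \<or> adj u x \<and> adj u z"
      "s u v" "v \<notin> {x, y, z}"
    and u': "u' \<notin> {x, y, z}" "adj u' x \<and> adj u' y \<or> adj u' y \<and> adj u' z \<or> adj u' x \<and> adj u' z"
      "s u' v'" "v' \<notin> {x, y, z}"
  shows "u = u'"
proof -
  note p = triangle_perm[OF t]
  have m: "u \<notin> {y, z, x}" "u \<notin> {x, z, y}" "u \<notin> {y, x, z}" "u \<notin> {z, y, x}" "u \<notin> {z, x, y}"
    "u' \<notin> {y, z, x}" "u' \<notin> {x, z, y}" "u' \<notin> {y, x, z}" "u' \<notin> {z, y, x}" "u' \<notin> {z, x, y}"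
    "v \<notin> {y, z, x}" "v \<notin> {x, z, y}" "v' \<notin> {y, z, x}" "v' \<notin> {x, z, y}"
    using u u' by auto
  from u(2) u'(2) show ?thesis
    using hubs_same[OF t u(1) _ _ u(3,4) u'(1) _ _ u'(3,4)]
      hubs_same[OF p(4) m(1) _ _ u(3) m(11) m(6) _ _ u'(3) m(13)]
      hubs_same[OF p(2) m(2) _ _ u(3) m(12) m(7) _ _ u'(3) m(14)]
      hubs_diff[OF t u(1) _ _ u'(1)] hubs_diff[OF p(1) m(3) _ _ m(8)]
      hubs_diff[OF p(2) m(2) _ _ m(7)] hubs_diff[OF p(3) m(4) _ _ m(9)]
      hubs_diff[OF p(4) m(1) _ _ m(6)] hubs_diff[OF p(5) m(5) _ _ m(10)]
    by blast
qed

text \<open>Each clique edge disjoint from the triangle has an end adjacent to two corners, a hub.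
  All hubs coincide by \<open>hubs_eq\<close>, which gives the fourth covering vertex
  \<open>p\<close>.\<close>

lemma triangle_cover:
  assumes t: "triangle x y z" and sees_two: "sees_two x y z"
  shows "\<exists>p. \<forall>u v. s u v \<longrightarrow> u \<in> {x, y, z, p} \<or> v \<in> {x, y, z, p}"
proof -
  define hub where "hub u \<longleftrightarrow> u \<notin> {x, y, z} \<and> (\<exists>v. s u v \<and> v \<notin> {x, y, z}) \<and>
    (adj u x \<and> adj u y \<or> adj u y \<and> adj u z \<or> adj u x \<and> adj u z)" for u
  have uniq: "u = u'" if "hub u" "hub u'" for u u'
    using that hubs_eq[OF t] unfolding hub_def by blast
  have ex: "hub u \<or> hub v" if uv: "s u v" "u \<notin> {x, y, z}" "v \<notin> {x, y, z}" for u v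
  proof -
    note p = triangle_perm[OF t]
    \<comment> \<open>Two corners cannot see the edge \<open>u v\<close> through different ends:
      \<open>a c b v u\<close> would be a 5-cycle. So the two corners from \<open>sees_two\<close>
      see the same end.\<close>
    have "\<not> (adj a u \<and> adj b v)"
      if abc: "triangle a b c" "{a, b, c} = {x, y, z}" for a b c
    proof
      assume "adj a u \<and> adj b v"
      moreover have "u \<notin> {a, b, c}" "v \<notin> {a, b, c}" "u \<noteq> v"
        using uv abc(2) s_adj adj_irrefl by auto
      ultimately show False
        using no5[of a c b v u] triangleD[OF abc(1)] s_adj[OF s_sym[OF uv(1)]] adj_sym[of a u]
        by auto
    qed
    note n = this[OF t refl] this[OF p(1)] this[OF p(2)] this[OF p(3)] this[OF p(4)] this[OF p(5)]
    have n: "\<not> (adj x u \<and> adj y v)" "\<not> (adj y u \<and> adj x v)" "\<not> (adj x u \<and> adj z v)"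
      "\<not> (adj z u \<and> adj y v)" "\<not> (adj y u \<and> adj z v)" "\<not> (adj z u \<and> adj x v)"
      using n by auto
    have "(adj x u \<or> adj x v) \<and> (adj y u \<or> adj y v) \<or> (adj y u \<or> adj y v) \<and> (adj z u \<or> adj z v) \<or>
     (adj x u \<or> adj x v) \<and> (adj z u \<or> adj z v)"
      using sees_two uv unfolding sees_two_def by blast
    then have "adj x u \<and> adj y u \<or> adj y u \<and> adj z u \<or> adj x u \<and> adj z u \<or>
      adj x v \<and> adj y v \<or> adj y v \<and> adj z v \<or> adj x v \<and> adj z v"
      using n by blast
    then show ?thesis
      unfolding hub_def using uv s_sym adj_sym by blast
  qed
  show ?thesis
  proof (cases "\<exists>p. hub p")
    case True
    then obtain p where "hub p" by blast
    then show ?thesis using ex uniq by (intro exI[of _ p]) blast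
  next
    case False
    then show ?thesis using ex by blast
  qed
qed

text \<open>Each side is linked to \<open>u v\<close>, so at most one corner fails to see that
  edge.\<close>

lemma sees_two_s_triangle:
  assumes "triangle x y z" "s x y" "s y z" "s x z"
  shows "sees_two x y z"
  unfolding sees_two_def
proof (intro allI impI)
  fix u v assume uv: "s u v" "u \<notin> {x, y, z}" "v \<notin> {x, y, z}"
  then have "u \<noteq> v" using s_adj adj_irrefl by auto
  then show "(adj x u \<or> adj x v) \<and> (adj y u \<or> adj y v) \<or>
    (adj y u \<or> adj y v) \<and> (adj z u \<or> adj z v) \<or> (adj x u \<or> adj x v) \<and> (adj z u \<or> adj z v)"
    using linked[OF assms(2) uv(1)] linked[OF assms(3) uv(1)] linked[OF assms(4) uv(1)]
      triangleD[OF assms(1)] uv(2,3) by auto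
qed

text \<open>The side \<open>x y\<close> provides one corner. The other is \<open>z\<close>: if it
  saw neither end, then \<open>c\<close> would, and this closes a 5-cycle with the corner already
  found.\<close>

lemma sees_two_s_edge:
  assumes t: "triangle x y z" and s: "s x y" "s z c" "c \<notin> {x, y, z}"
  shows "sees_two x y z"
  unfolding sees_two_def
proof (intro allI impI)
  have bad: False
    if "s u v" "adj c u" "adj a u \<or> adj a v" "{a, b} = {x, y}" "u \<notin> {x, y, z, c}" "v \<notin> {x, y, z, c}"
    for u v a b
  proof -
    have "u \<noteq> v" using that(1) s_adj adj_irrefl by blast
    then have d: "adj a b" "adj b a" "adj a z" "adj z b" "a \<noteq> b" "a \<noteq> z" "b \<noteq> z" "u \<noteq> v"
      "u \<notin> {a, b, z, c}" "v \<notin> {a, b, z, c}" "c \<notin> {a, b, z}" "adj c z" "adj z c" "adj u c" "adj u v"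
      using that triangleD[OF t] s s_adj adj_sym adj_irrefl by (auto simp: doubleton_eq_iff)
    show False
      using that(3)
    proof
      assume "adj a u"
      then show False using no5[of c z b a u] d by auto
    next
      assume "adj a v"
      then show False using no5[of v a z c u] d that(2) adj_sym[of a v] by auto
    qed
  qed
  fix u v assume uv: "s u v" "u \<notin> {x, y, z}" "v \<notin> {x, y, z}"
  have ne: "u \<noteq> v" "x \<noteq> y" "z \<noteq> c" using uv s s_adj adj_irrefl by auto
  have xy: "(adj x u \<or> adj x v) \<or> (adj y u \<or> adj y v)"
    using linked[OF s(1) uv(1)] ne uv by auto
  have "adj z u \<or> adj z v"
  proof (rule ccontr)
    assume nz: "\<not> (adj z u \<or> adj z v)"
    then have c: "c \<noteq> u" "c \<noteq> v" using s s_adj by auto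
    then have "adj c u \<or> adj c v" using linked[OF s(2) uv(1)] nz ne uv by auto
    then show False
      using bad[OF uv(1), of x y] bad[OF uv(1), of y x]
        bad[OF s_sym[OF uv(1)], of x y] bad[OF s_sym[OF uv(1)], of y x] xy uv c
      by auto
  qed
  then show "(adj x u \<or> adj x v) \<and> (adj y u \<or> adj y v) \<or>
    (adj y u \<or> adj y v) \<and> (adj z u \<or> adj z v) \<or> (adj x u \<or> adj x v) \<and> (adj z u \<or> adj z v)"
    using xy by blast
qed

text \<open>By symmetry it suffices that \<open>x\<close> or \<open>y\<close> sees
  \<open>u v\<close>. If not, \<open>a\<close> is adjacent to one end, say \<open>u\<close>;
  forbidding 5-cycles forces \<open>b\<close> to be adjacent to \<open>v\<close>, then keeps
  \<open>z\<close> away from both ends, and finally leaves no end for \<open>c\<close>.\<close>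

lemma sees_two_pendants:
  assumes t: "triangle x y z" and s: "s x a" "s y b" "s z c"
    and d: "distinct [a, b, c]" "a \<notin> {x, y, z}" "b \<notin> {x, y, z}" "c \<notin> {x, y, z}"
  shows "sees_two x y z"
proof -
  have bad: False
    if t: "triangle x y z" and s: "s x a" "s y b" "s z c"
      and d: "distinct [a, b, c]" "a \<notin> {x, y, z}" "b \<notin> {x, y, z}" "c \<notin> {x, y, z}"
      and uv: "s u v" "u \<notin> {x, y, z}" "v \<notin> {x, y, z}"
      and n: "\<not> adj x u" "\<not> adj x v" "\<not> adj y u" "\<not> adj y v" and au: "adj a u"
    for x y z a b c u v
  proof -
    note sa = s_adj[OF s(1)] s_adj[OF s(2)] s_adj[OF s(3)]
    note ad = triangleD[OF t] sa sa[THEN adj_sym] au adj_sym[OF au] s_adj[OF uv(1)]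
      s_adj[OF s_sym[OF uv(1)]]
    have ne: "u \<noteq> v" "a \<noteq> u" "a \<noteq> v" "b \<noteq> u" "b \<noteq> v" using ad n adj_irrefl by auto
    have "\<not> adj b u"
    proof
      assume "adj b u"
      then show False using no5[of u a x y b] ad ne d uv by auto
    qed
    then have "adj b v" using linked[OF s(2) uv(1)] n ne d uv by auto
    have z: "\<not> adj z u" "\<not> adj z v"
    proof -
      show "\<not> adj z u"
      proof
        assume "adj z u"
        then show False using no5[of z u v b y] ad ne d uv \<open>adj b v\<close> adj_sym[OF \<open>adj b v\<close>] by auto
      qed
      show "\<not> adj z v"
      proof
        assume "adj z v"
        then show False using no5[of z v u a x] ad ne d uv by auto
      qed
    qed
    then have cne: "c \<noteq> u" "c \<noteq> v" using ad by auto
    then have "adj c u \<or> adj c v" using linked[OF s(3) uv(1)] z ne d uv by auto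
    then show False
    proof
      assume "adj c u"
      then show False using no5[of u a x z c] ad ne d uv cne by auto
    next
      assume "adj c v"
      then show False using no5[of v b y z c] ad ne d uv cne adj_sym[OF \<open>adj b v\<close>] by auto
    qed
  qed
  have bad2: "(adj x u \<or> adj x v) \<or> (adj y u \<or> adj y v)"
    if t: "triangle x y z" and s: "s x a" "s y b" "s z c"
      and d: "distinct [a, b, c]" "a \<notin> {x, y, z}" "b \<notin> {x, y, z}" "c \<notin> {x, y, z}"
      and uv: "s u v" "u \<notin> {x, y, z}" "v \<notin> {x, y, z}"
    for x y z a b c u v
  proof (rule ccontr)
    assume n: "\<not> ?thesis"
    then have "a \<noteq> u" "a \<noteq> v" "u \<noteq> v" "x \<noteq> a" using s s_adj uv adj_irrefl by auto
    then have "adj a u \<or> adj a v" using linked[OF s(1) uv(1)] n uv by auto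
    then show False
      using bad[OF t s d uv] bad[OF t s d s_sym[OF uv(1)] uv(3,2)] n by auto
  qed
  note p = triangle_perm[OF t]
  show ?thesis
    unfolding sees_two_def
  proof (intro allI impI)
    fix u v assume uv: "s u v" "u \<notin> {x, y, z}" "v \<notin> {x, y, z}"
    have "(adj x u \<or> adj x v) \<or> (adj y u \<or> adj y v)" using bad2[OF t s d uv] .
    moreover have "(adj y u \<or> adj y v) \<or> (adj z u \<or> adj z v)"
      by (rule bad2[OF p(4) s(2,3,1) _ _ _ _ uv(1)]) (use d uv in auto)
    moreover have "(adj x u \<or> adj x v) \<or> (adj z u \<or> adj z v)"
      by (rule bad2[OF p(2) s(1,3,2) _ _ _ _ uv(1)]) (use d uv in auto)
    ultimately show "(adj x u \<or> adj x v) \<and> (adj y u \<or> adj y v) \<or>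
      (adj y u \<or> adj y v) \<and> (adj z u \<or> adj z v) \<or> (adj x u \<or> adj x v) \<and> (adj z u \<or> adj z v)"
      by blast
  qed
qed

text \<open>Either all sides are clique edges, or some clique side has a clique edge leaving the
  triangle at the opposite corner. The definition of \<open>link\<close> supplies that edge when
  \<open>z\<close> has none.\<close>

lemma link_triangle_sees_two_edge:
  assumes l: "link x y" "link y z" "link x z" and xy: "s x y"
  shows "sees_two x y z"
proof -
  have t: "triangle x y z" using l link_adj unfolding triangle_def by blast
  note ne = triangleD(7-9)[OF t] and p = triangle_perm[OF t]
  show ?thesis
  proof (cases "\<exists>c. s z c \<and> c \<notin> {x, y, z}")
    case True
    then show ?thesis using sees_two_s_edge[OF t xy] by blast
  next
    case False
    then have z: "c = x \<or> c = y" if "s z c" for c using that s_adj adj_irrefl by blast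
    consider "s y z" "s x z" | "s x z" "\<not> s y z" | "\<not> s x z" by blast
    then show ?thesis
    proof cases
      case 1
      then show ?thesis using sees_two_s_triangle[OF t xy] by blast
    next
      case 2
      then obtain a b where "s y a" "s z b" "distinct [y, a, z, b]" using l(2) unfolding link_def by blast
      then have "s y a" "a \<notin> {x, z, y}" using z[of b] by auto
      then show ?thesis using sees_two_s_edge[OF p(2) 2(1)] sees_two_perm(2) by blast
    next
      case 3
      then obtain a b where ab: "s x a" "s z b" "distinct [x, a, z, b]" using l(3) unfolding link_def by blast
      then have "b = y" using z[of b] by auto
      then have "s y z" "s x a" "a \<notin> {y, z, x}" using ab s_sym by auto
      then show ?thesis using sees_two_s_edge[OF p(4)] sees_two_perm(5) by blast
    qed
  qed
qed

lemma link_triangle_sees_two: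
  assumes l: "link x y" "link y z" "link x z"
  shows "sees_two x y z"
proof -
  have t: "triangle x y z" using l link_adj unfolding triangle_def by blast
  note ad = triangleD[OF t]
  consider "s x y" | "s y z" | "s x z" | "\<not> s x y" "\<not> s y z" "\<not> s x z" by blast
  then show ?thesis
  proof cases
    case 1
    then show ?thesis using link_triangle_sees_two_edge[OF l] by blast
  next
    case 2
    then show ?thesis
      using link_triangle_sees_two_edge[of y z x] l link_sym sees_two_perm(5) by blast
  next
    case 3
    then show ?thesis
      using link_triangle_sees_two_edge[of x z y] l link_sym sees_two_perm(2) by blast
  next
    case 4
    have out: "w \<notin> {x, y, z}" if "s x w \<or> s y w \<or> s z w" for w
      using that 4 s_sym s_adj adj_irrefl by blast
    obtain a1 b1 where 1: "s x a1" "s y b1" "a1 \<noteq> b1" using 4 l(1) unfolding link_def by auto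
    obtain b3 c3 where 3: "s y b3" "s z c3" "b3 \<noteq> c3" using 4 l(2) unfolding link_def by auto
    obtain a2 c2 where 2: "s x a2" "s z c2" "a2 \<noteq> c2" using 4 l(3) unfolding link_def by auto
    note sa = 1(1,2)[THEN s_adj] 2(1,2)[THEN s_adj] 3(1,2)[THEN s_adj]
    note sa' = sa sa[THEN adj_sym]
    have o: "a1 \<notin> {x, y, z}" "b1 \<notin> {x, y, z}" "a2 \<notin> {x, y, z}" "c2 \<notin> {x, y, z}"
      "b3 \<notin> {x, y, z}" "c3 \<notin> {x, y, z}" using out 1 2 3 by blast+
    \<comment> \<open>Distinct representatives: if there are none, the clique edges at
      \<open>x\<close>, \<open>y\<close>, \<open>z\<close> run to \<open>a1\<close> and
      \<open>b1\<close> in such a way that these two and the triangle carry a 5-cycle.\<close>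
    have "\<exists>a b c. s x a \<and> s y b \<and> s z c \<and> distinct [a, b, c]"
    proof (rule ccontr)
      assume "\<not> ?thesis"
      then have n: "a = b \<or> b = c \<or> a = c" if "s x a" "s y b" "s z c" for a b c using that by auto
      have c2: "c2 = a1 \<or> c2 = b1" and c3: "c3 = a1 \<or> c3 = b1" using n 1 2 3 by metis+
      show False
      proof (cases "c2 = a1")
        case True
        then have "a2 = b1" using n[of a2 b1 c2] 1 2 by metis
        then show False using no5[of a1 z y b1 x] True sa' ad o 1 by auto
      next
        case False
        then have "c2 = b1" using c2 by simp
        show False
        proof (cases "c3 = a1")
          case True
          then show False using no5[of a1 x y b1 z] \<open>c2 = b1\<close> sa' ad o 1 by auto
        next
          case False
          then have "c3 = b1" using c3 by simp
          then have "b3 = a1" using n[of a1 b3 c3] 1 3 by metis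
          then show False using no5[of a1 x z b1 y] \<open>c3 = b1\<close> sa' ad o 1 by auto
        qed
      qed
    qed
    then show ?thesis using sees_two_pendants[OF t] out by blast
  qed
qed

text \<open>If the linking edges span no triangle, then every vertex that meets \<open>s\<close> lies within distance two
  of a fixed edge \<open>x y\<close>, and forbidding 3- and 5-cycles makes the two sides of the
  breadth-first search from this edge independent.\<close>

definition side :: "'a \<Rightarrow> 'a \<Rightarrow> 'a set" where
  "side x y = {v. link y v \<or> \<not> link x v \<and> \<not> link y v \<and> (\<exists>p. link x p \<and> link p v)}"

text \<open>Two linked neighbours of \<open>y\<close> give a triangle. If only \<open>u\<close> is a
  neighbour of \<open>y\<close>, the 5-cycle is \<open>y u v p x\<close>; if both are at distance
  two through \<open>x\<close>, it is \<open>x p u v q\<close>.\<close>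

lemma side_independent:
  assumes no3: "\<nexists>a b c. link a b \<and> link b c \<and> link a c" and xy: "s x y"
    and uv: "link u v" "u \<in> side x y" "v \<in> side x y"
  shows False
proof -
  have l: "link x y" "link y x" using xy s_link link_sym by blast+
  have irr: "\<not> link w w" for w using link_adj adj_irrefl by blast
  have mixed: False if h: "link u v" "link y u" "\<not> link x v" "\<not> link y v" "link x p" "link p v" for u v p
  proof -
    have "\<not> link u p" "u \<noteq> p" "u \<noteq> x" "p \<noteq> y" "v \<noteq> x" "v \<noteq> y" "p \<noteq> x" "u \<noteq> y" "x \<noteq> y" "u \<noteq> v" "p \<noteq> v"
      using h l irr no3 link_sym by metis+
    then show False
      using no5[of y u v p x] link_adj h l link_sym by auto
  qed
  have far: False if h: "link u v" "\<not> link x u" "\<not> link y u" "link x p" "link p u"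
    "\<not> link x v" "\<not> link y v" "link x q" "link q v" for p q
  proof -
    have "p \<noteq> q" "u \<noteq> x" "v \<noteq> x" "u \<noteq> v" "p \<noteq> x" "q \<noteq> x" "p \<noteq> u" "q \<noteq> v" "p \<noteq> v" "q \<noteq> u"
      using h l irr no3 link_sym by metis+
    then show False
      using no5[of x p u v q] link_adj h l link_sym by auto
  qed
  show False
    using uv no3 mixed[of u v] mixed[of v u] far link_sym unfolding side_def mem_Collect_eq by metis
qed

lemma bipartite:
  assumes no3: "\<nexists>a b c. link a b \<and> link b c \<and> link a c"
  shows "\<exists>A B. A \<inter> B = {} \<and> (\<forall>u v. link u v \<longrightarrow> u \<in> A \<and> v \<in> B \<or> u \<in> B \<and> v \<in> A)"
proof (cases "\<exists>x y. s x y")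
  case True
  then obtain x y where xy: "s x y" by blast
  then have yx: "s y x" by (rule s_sym)
  have l: "link x y" "link y x" using xy s_link link_sym by blast+
  have irr: "\<not> link w w" for w using link_adj adj_irrefl by blast
  have "side x y \<inter> side y x = {}"
  proof -
    \<comment> \<open>A vertex at distance two from both ends of the edge lies on the 5-cycle
      \<open>x p v q y\<close>.\<close>
    have False if h: "link x p" "link p v" "link y q" "link q v" "\<not> link x v" "\<not> link y v" for v p q
    proof -
      have "p \<noteq> q" "p \<noteq> y" "q \<noteq> x" "v \<noteq> x" "v \<noteq> y" "p \<noteq> x" "q \<noteq> y" "p \<noteq> v" "q \<noteq> v" "x \<noteq> y"
        using h l irr no3 link_sym by metis+
      then show False using no5[of x p v q y] link_adj h l link_sym by auto
    qed
    moreover have "\<not> (link x v \<and> link y v)" for v using no3 l by blast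
    ultimately show ?thesis unfolding side_def by blast
  qed
  moreover have cover: "u \<in> side x y \<union> side y x" if "s u w" for u w
  proof -
    have "u = x \<or> u = y \<or> w = x \<or> w = y \<or> (adj x u \<or> adj y u \<or> adj x w \<or> adj y w) \<and> distinct [x, y, u, w]"
      using linked[OF xy that] xy that s_adj adj_irrefl by auto
    then have "link x u \<or> link y u \<or> (\<exists>p. (link x p \<or> link y p) \<and> link p u)"
    proof (elim disjE)
      assume h: "(adj x u \<or> adj y u \<or> adj x w \<or> adj y w) \<and> distinct [x, y, u, w]"
      \<comment> \<open>The edge that joins \<open>x y\<close> to a disjoint clique edge is itself a
        link, so the search reaches \<open>u\<close> within two steps.\<close>
      then have "link x u \<or> link y u \<or> link x w \<or> link y w"
      proof -
        have d: "distinct [x, y, u, w]" "distinct [y, x, u, w]" "distinct [x, y, w, u]"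
          "distinct [y, x, w, u]" using h by auto
        show ?thesis
          unfolding link_def using h d xy yx that s_sym[OF that] by blast
      qed
      then show ?thesis using s_link[OF s_sym[OF that]] by blast
    qed (use l s_link[OF that] link_sym in blast)+
    then show ?thesis unfolding side_def by blast
  qed
  moreover have "u \<in> side x y \<and> v \<in> side y x \<or> u \<in> side y x \<and> v \<in> side x y" if "link u v" for u v
    using cover link_s[OF that] link_s[OF link_sym[OF that]] side_independent[OF no3 xy that]
      side_independent[OF no3 yx that] by blast
  ultimately show ?thesis by blast
next
  case False
  then show ?thesis unfolding link_def by (intro exI[of _ "{}"]) blast
qed

end

section \<open>Strong cliques in graphs\<close>

lemma graph_free_insert:
  "graph_free (insert F \<F>) G \<longleftrightarrow> graph_free {F} G \<and> graph_free \<F> G"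
  unfolding graph_free_def by blast

lemma finite_edges: "simple_graph G \<Longrightarrow> finite (edges G)"
  unfolding simple_graph_def by (meson Pow_iff finite_Pow_iff finite_subset subsetI)

lemma not_cycle_free:
  assumes "simple_graph G" and vs: "distinct vs" "length vs = n" "3 \<le> n"
    and edge: "\<And>i. i < n \<Longrightarrow> {vs ! i, vs ! ((i + 1) mod n)} \<in> edges G"
  shows "\<not> graph_free {cycle_graph n} G"
proof -
  define H where "H = Graph (set vs) ((\<lambda>i. {vs ! i, vs ! ((i + 1) mod n)}) ` {..<n})"
  have e: "e \<subseteq> verts G \<and> card e = 2" if "e \<in> edges G" for e
    using assms(1) that unfolding simple_graph_def by blast
  have "verts H \<subseteq> verts G"
  proof
    fix v assume "v \<in> verts H"
    then obtain i where "i < n" "v = vs ! i" unfolding H_def by (auto simp: in_set_conv_nth vs)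
    then show "v \<in> verts G" using e[OF edge[of i]] by blast
  qed
  moreover have "edges H \<subseteq> edges G" unfolding H_def using edge by auto
  moreover have "f \<subseteq> verts H" if f: "f \<in> edges H" for f
  proof -
    obtain i where i: "f = {vs ! i, vs ! ((i + 1) mod n)}" "i \<in> {..<n}"
      using f unfolding H_def graph.sel by (rule imageE)
    moreover have "(i + 1) mod n < n" using vs(3) by simp
    ultimately show ?thesis unfolding H_def using vs(2) by auto
  qed
  moreover have "finite (verts H)" unfolding H_def by simp
  ultimately have "subgraph H G"
    unfolding subgraph_def simple_graph_def using e by blast
  moreover have "graph_iso (cycle_graph n) H"
    unfolding graph_iso_def
  proof (intro exI conjI)
    show "bij_betw ((!) vs) (verts (cycle_graph n)) (verts H)"
      unfolding cycle_graph_def H_def using bij_betw_nth[OF vs(1), of "{..<n}"] vs(2) by simp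
    show "edges H = (`) ((!) vs) ` edges (cycle_graph n)"
      unfolding cycle_graph_def H_def by (simp add: image_image)
  qed
  ultimately show ?thesis unfolding graph_free_def by blast
qed

lemma not_free_bicycle:
  assumes "simple_graph G" and ps: "bicycle E ps" "length ps = k" "2 \<le> k"
    and E: "\<And>a b. (a, b) \<in> E \<Longrightarrow> {a, b} \<in> edges G \<and> a \<in> A \<and> b \<in> B" "A \<inter> B = {}"
  shows "\<not> graph_free {cycle_graph (2 * k)} G"
proof -
  define f where "f i = (if even i then fst (ps ! (i div 2)) else snd (ps ! (i div 2)))" for i
  have sub: "ps ! j \<in> E" if "j < k" for j
    using ps that unfolding bicycle_def by (metis nth_mem subset_iff)
  have next_edge: "(fst (ps ! Suc j), snd (ps ! j)) \<in> E" if "Suc j < k" for j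
    using ps that unfolding bicycle_def by (simp add: successively_conv_nth)
  have close: "(fst (ps ! 0), snd (ps ! (k - 1))) \<in> E"
    using ps unfolding bicycle_def by (metis hd_conv_nth last_conv_nth)
  have d: "distinct (map fst ps)" "distinct (map snd ps)" using ps(1) unfolding bicycle_def by auto
  have side: "fst (ps ! j) \<in> A" "snd (ps ! j) \<in> B" if "j < k" for j
    using sub[OF that] E(1)[of "fst (ps ! j)" "snd (ps ! j)"] by auto
  have inj: "inj_on f {..<2 * k}"
  proof (rule inj_onI)
    fix i j assume ij: "i \<in> {..<2 * k}" "j \<in> {..<2 * k}" "f i = f j"
    have lt: "i div 2 < k" "j div 2 < k" using ij by auto
    have par: "even i = even j"
      using ij(3) side[OF lt(1)] side[OF lt(2)] E(2) unfolding f_def by (auto split: if_splits)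
    have "i div 2 = j div 2"
    proof (cases "even i")
      case True
      then have "map fst ps ! (i div 2) = map fst ps ! (j div 2)"
        using ij(3) par lt ps(2) unfolding f_def by simp
      then show ?thesis using d(1) lt ps(2) by (simp only: nth_eq_iff_index_eq length_map)
    next
      case False
      then have "map snd ps ! (i div 2) = map snd ps ! (j div 2)"
        using ij(3) par lt ps(2) unfolding f_def by simp
      then show ?thesis using d(2) lt ps(2) by (simp only: nth_eq_iff_index_eq length_map)
    qed
    then show "i = j" using par by (metis dvd_mult_div_cancel odd_two_times_div_two_succ)
  qed
  have "\<not> graph_free {cycle_graph (length (map f [0..<2 * k]))} G"
  proof (rule not_cycle_free[OF assms(1) _ refl])
    show "distinct (map f [0..<2 * k])" using inj by (simp add: distinct_map atLeast0LessThan)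
    show "3 \<le> length (map f [0..<2 * k])" using ps(3) by simp
    fix i assume "i < length (map f [0..<2 * k])"
    then have i: "i < 2 * k" by simp
    have m: "(i + 1) mod (2 * k) < 2 * k" using i by simp
    have "{f i, f ((i + 1) mod (2 * k))} \<in> edges G"
    proof (cases "even i")
      case True
      then obtain j where j: "i = 2 * j" by blast
      then have "f i = fst (ps ! j)" "f ((i + 1) mod (2 * k)) = snd (ps ! j)" "j < k"
        using i unfolding f_def by auto
      then show ?thesis using E(1)[of "fst (ps ! j)" "snd (ps ! j)"] sub[of j] by simp
    next
      case False
      then obtain j where j: "i = Suc (2 * j)" using oddE by fastforce
      then have fi: "f i = snd (ps ! j)" "j < k" using i unfolding f_def by auto
      show ?thesis
      proof (cases "Suc j < k")
        case True
        then have "(i + 1) mod (2 * k) = 2 * Suc j" using j by simp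
        then have "f ((i + 1) mod (2 * k)) = fst (ps ! Suc j)" unfolding f_def by simp
        then show ?thesis using fi E(1)[OF next_edge[OF True]] by (simp add: insert_commute)
      next
        case False
        then have jk: "j = k - 1" "i + 1 = 2 * k" using fi j by auto
        then have "f ((i + 1) mod (2 * k)) = fst (ps ! 0)" unfolding f_def by simp
        then show ?thesis using fi E(1)[OF close] jk by (simp add: insert_commute)
      qed
    qed
    then show "{map f [0..<2 * k] ! i, map f [0..<2 * k] ! ((i + 1) mod length (map f [0..<2 * k]))} \<in> edges G"
      using i m by simp
  qed
  then show ?thesis by simp
qed

text \<open>For disjoint edges a shortest path in the line graph has exactly one inner vertex
  \<open>g\<close>, which is the linking edge.\<close>

lemma edge_dist_le_2:
  assumes G: "simple_graph G" and e: "e \<in> edges G" and dist: "edge_dist G e f \<le> 2"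
    and disj: "e \<inter> f = {}"
  shows "\<exists>u\<in>e. \<exists>v\<in>f. {u, v} \<in> edges G"
proof -
  let ?L = "line_graph G"
  have meet: "x \<inter> y \<noteq> {}" "y \<in> edges G" if "{x, y} \<in> edges ?L" for x y
    using that unfolding line_graph_def by (auto simp: doubleton_eq_iff)
  \<comment> \<open>The strict form yields an actual path from the infimum.\<close>
  have "edge_dist G e f < 3" using dist by (rule order.strict_trans1) simp
  then obtain p where p: "path_between ?L e p f" "enat (length p - 1) < 3"
    unfolding edge_dist_def graph_dist_def INF_less_iff by blast
  have len: "length p \<le> 3" using p(2) by (simp add: numeral_eq_enat)
  have p1: "hd p = e" "last p = f" "p \<noteq> []" "successively (\<lambda>x y. {x, y} \<in> edges ?L) p"
    using p(1) unfolding path_between_def by auto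
  have "e \<noteq> {}" using G e unfolding simple_graph_def by force
  then have "e \<noteq> f" using disj by auto
  moreover have "{e, f} \<notin> edges ?L" using meet(1)[of e f] disj by blast
  ultimately obtain g where g: "p = [e, g, f]"
    using len p1 by (cases p; cases "tl p"; cases "tl (tl p)") auto
  then have eg: "{e, g} \<in> edges ?L" and gf: "{g, f} \<in> edges ?L" using p1(4) by auto
  obtain u v where uv: "u \<in> e" "u \<in> g" "v \<in> g" "v \<in> f" using meet(1)[OF eg] meet(1)[OF gf] by blast
  have "u \<noteq> v" using uv disj by blast
  moreover have "card g = 2" "g \<in> edges G" using meet(2)[OF eg] G unfolding simple_graph_def by auto
  ultimately have "g = {u, v}" using uv by (auto simp: card_2_iff)
  then show ?thesis using uv \<open>g \<in> edges G\<close> by blast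
qed

lemma card_incident_le:
  assumes "simple_graph G"
  shows "card {e \<in> edges G. v \<in> e} \<le> max_degree G"
proof (cases "v \<in> verts G")
  case True
  have "finite (insert 0 (degree G ` verts G))" using assms unfolding simple_graph_def by simp
  then have "degree G v \<le> max_degree G" unfolding max_degree_def using True by (intro Max_ge) auto
  then show ?thesis unfolding degree_def .
next
  case False
  then have "{e \<in> edges G. v \<in> e} = {}" using assms unfolding simple_graph_def by blast
  then show ?thesis by (metis card.empty le0)
qed

lemma card_nbrs_le:
  assumes "simple_graph G"
  shows "card {v. {u, v} \<in> edges G} \<le> max_degree G"
proof -
  have "card {v. {u, v} \<in> edges G} \<le> card {e \<in> edges G. u \<in> e}"
    using finite_edges[OF assms]
    by (intro card_inj_on_le[of "\<lambda>v. {u, v}"]) (auto simp: inj_on_def doubleton_eq_iff)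
  then show ?thesis using card_incident_le[OF assms] le_trans by blast
qed

text \<open>The degrees of the four vertices sum to at most \<open>4 * max_degree G\<close>, and
  this sum counts each edge of the triangle twice.\<close>

lemma card_triangle_cover:
  assumes G: "simple_graph G" and S: "S \<subseteq> edges G" "\<And>e. e \<in> S \<Longrightarrow> e \<inter> {x, y, z, p} \<noteq> {}"
    and t: "{x, y} \<in> edges G" "{y, z} \<in> edges G" "{x, z} \<in> edges G" "x \<noteq> y" "y \<noteq> z" "x \<noteq> z"
  shows "card S + 3 \<le> 4 * max_degree G"
proof -
  define I where "I v = {e \<in> edges G. v \<in> e}" for v
  have fin: "finite (I v)" for v unfolding I_def using finite_edges[OF G] by simp
  have le: "card (I v) \<le> max_degree G" for v unfolding I_def by (rule card_incident_le[OF G])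
  have "card {{x, y}} \<le> card (I x \<inter> I y)"
    using fin t by (intro card_mono) (auto simp: I_def)
  moreover have "card {{x, z}, {y, z}} \<le> card ((I x \<union> I y) \<inter> I z)"
    using fin t by (intro card_mono) (auto simp: I_def)
  moreover have "card {{x, z}, {y, z}} = 2" using t by (simp add: doubleton_eq_iff)
  moreover have "card (I x) + card (I y) = card (I x \<union> I y) + card (I x \<inter> I y)"
    using fin by (intro card_Un_Int)
  moreover have "card (I x \<union> I y) + card (I z) = card (I x \<union> I y \<union> I z) + card ((I x \<union> I y) \<inter> I z)"
    using fin by (intro card_Un_Int) auto
  moreover have "card (I x \<union> I y \<union> I z \<union> I p) \<le> card (I x \<union> I y \<union> I z) + card (I p)"
    by (rule card_Un_le)
  moreover have "card S \<le> card (I x \<union> I y \<union> I z \<union> I p)"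
    using S fin by (intro card_mono) (auto simp: I_def)
  ultimately show ?thesis using le[of x] le[of y] le[of z] le[of p] by simp
qed

lemma strong_clique_bound:
  assumes G: "simple_graph G" and k: "2 \<le> k" and D: "1 \<le> max_degree G"
    and c5: "graph_free {cycle_graph 5} G" and c2k: "graph_free {cycle_graph (2 * k)} G"
    and k3: "4 \<le> k \<or> graph_free {cycle_graph 3} G"
    and S: "strong_clique G S"
  shows "card S + (k - 1) \<le> k * max_degree G"
proof -
  define adj where "adj u v \<longleftrightarrow> {u, v} \<in> edges G" for u v
  define s where "s u v \<longleftrightarrow> {u, v} \<in> S" for u v
  have sub: "S \<subseteq> edges G" using S unfolding strong_clique_def by blast
  interpret linked_edges adj s
  proof
    show "adj v u" if "adj u v" for u v using that unfolding adj_def by (simp add: insert_commute)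
    show "s v u" if "s u v" for u v using that unfolding s_def by (simp add: insert_commute)
    show "\<not> adj u u" for u using G unfolding adj_def simple_graph_def by force
    show "adj u v" if "s u v" for u v using that sub unfolding adj_def s_def by blast
    show "adj a c \<or> adj a d \<or> adj b c \<or> adj b d" if "s a b" "s c d" "distinct [a, b, c, d]" for a b c d
      using edge_dist_le_2[OF G, of "{a, b}" "{c, d}"] that S
      unfolding s_def adj_def strong_clique_def by auto
    show False if h: "adj a b" "adj b c" "adj c d" "adj d e" "adj e a" "distinct [a, b, c, d, e]"
      for a b c d e
    proof -
      have "{[a, b, c, d, e] ! i, [a, b, c, d, e] ! ((i + 1) mod 5)} \<in> edges G" if "i < 5" for i
      proof -
        have "i = 0 \<or> i = 1 \<or> i = 2 \<or> i = 3 \<or> i = 4" using that by auto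
        then show ?thesis using h(1-5) unfolding adj_def by auto
      qed
      then show False using not_cycle_free[OF G h(6), of 5] c5 by simp
    qed
  qed
  have S_cases: "\<exists>u v. e = {u, v} \<and> s u v" if "e \<in> S" for e
  proof -
    have "card e = 2" using that sub G unfolding simple_graph_def by blast
    then show ?thesis using that unfolding s_def by (metis card_2_iff)
  qed
  show ?thesis
  proof (cases "\<exists>x y z. link x y \<and> link y z \<and> link x z")
    case True
    then obtain x y z where l: "link x y" "link y z" "link x z" by blast
    then have t: "triangle x y z" using link_adj unfolding triangle_def by blast
    have "4 \<le> k"
    proof (rule ccontr)
      assume "\<not> 4 \<le> k"
      have "{[x, y, z] ! i, [x, y, z] ! ((i + 1) mod 3)} \<in> edges G" if "i < 3" for i
      proof -
        have "i = 0 \<or> i = 1 \<or> i = 2" using that by auto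
        then show ?thesis using triangleD[OF t] unfolding adj_def by auto
      qed
      then show False
        using not_cycle_free[OF G, of "[x, y, z]" 3] triangleD(7-9)[OF t] k3 \<open>\<not> 4 \<le> k\<close> by simp
    qed
    obtain p where p: "s u v \<longrightarrow> u \<in> {x, y, z, p} \<or> v \<in> {x, y, z, p}" for u v
      using triangle_cover[OF t link_triangle_sees_two[OF l]] by blast
    have "e \<inter> {x, y, z, p} \<noteq> {}" if "e \<in> S" for e using S_cases[OF that] p by blast
    then have "card S + 3 \<le> 4 * max_degree G"
      using card_triangle_cover[OF G sub, of x y z p] triangleD[OF t] unfolding adj_def by blast
    \<comment> \<open>Passes from the bound for \<open>k = 4\<close> to larger \<open>k\<close>:
      each step adds \<open>max_degree G - 1 \<ge> 0\<close>.\<close>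
    moreover have "(k - 4) * 1 \<le> (k - 4) * max_degree G" using D by (intro mult_left_mono) auto
    moreover have "4 * max_degree G + (k - 4) * max_degree G = k * max_degree G"
      using \<open>4 \<le> k\<close> by (simp flip: add_mult_distrib)
    ultimately show ?thesis using \<open>4 \<le> k\<close> by linarith
  next
    case False
    then obtain A B where AB: "A \<inter> B = {}"
      and cross: "link u v \<Longrightarrow> u \<in> A \<and> v \<in> B \<or> u \<in> B \<and> v \<in> A" for u v
      using bipartite by blast
    define E where "E = {(a, b). a \<in> A \<and> b \<in> B \<and> adj a b}"
    define T where "T = {(a, b). a \<in> A \<and> b \<in> B \<and> s a b}"
    have "crossing E T (max_degree G)"
    proof
      have "E \<subseteq> verts G \<times> verts G"
        using G unfolding E_def adj_def simple_graph_def by blast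
      then show "finite E" using G unfolding simple_graph_def by (meson finite_SigmaI finite_subset)
      show "T \<subseteq> E" unfolding E_def T_def using s_adj by blast
      have fin: "finite {v. {u, v} \<in> edges G}" for u
      proof (rule finite_subset)
        show "{v. {u, v} \<in> edges G} \<subseteq> verts G" "finite (verts G)"
          using G unfolding simple_graph_def by blast+
      qed
      show "card (E `` {a}) \<le> max_degree G" for a
      proof -
        have "E `` {a} \<subseteq> {v. {a, v} \<in> edges G}" unfolding E_def adj_def by auto
        then show ?thesis using card_mono[OF fin] card_nbrs_le[OF G] le_trans by blast
      qed
      show "card (E\<inverse> `` {b}) \<le> max_degree G" for b
      proof -
        have "E\<inverse> `` {b} \<subseteq> {v. {b, v} \<in> edges G}"
          unfolding E_def adj_def by (auto simp: insert_commute)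
        then show ?thesis using card_mono[OF fin] card_nbrs_le[OF G] le_trans by blast
      qed
      show "(a, b') \<in> E \<or> (a', b) \<in> E" if "(a, b) \<in> T" "(a', b') \<in> T" for a b a' b'
      proof (cases "a = a' \<or> b = b'")
        case True
        then show ?thesis using that \<open>T \<subseteq> E\<close> by blast
      next
        case False
        have s: "s a b" "s a' b'" "s b a" "s b' a'" and ab: "a \<in> A" "b \<in> B" "a' \<in> A" "b' \<in> B"
          using that s_sym unfolding T_def by auto
        then have d: "distinct [a, b, a', b']" "distinct [b, a, a', b']" "distinct [a, b, b', a']"
          "distinct [b, a, b', a']" using False AB by auto
        then have "link a a' \<or> link a b' \<or> link b a' \<or> link b b'"
          using linked[OF s(1,2) d(1)] s unfolding link_def by blast
        \<comment> \<open>A link inside \<open>A\<close> or inside \<open>B\<close> contradicts the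
          bipartition.\<close>
        then have "link a b' \<or> link b a'" using cross ab AB by blast
        then show ?thesis using link_adj ab adj_sym unfolding E_def by blast
      qed
    qed
    moreover have "\<nexists>ps. bicycle E ps \<and> length ps = k"
      using not_free_bicycle[OF G, of E _ k A B] k AB c2k unfolding E_def adj_def by blast
    ultimately have "card T + (k - 1) \<le> k * max_degree G"
      using crossing.crossing_bound[OF _ k D] by blast
    moreover have "S \<subseteq> (\<lambda>(a, b). {a, b}) ` T"
    proof
      fix e assume "e \<in> S"
      then obtain u v where "e = {u, v}" "s u v" using S_cases by blast
      then have "(u, v) \<in> T \<or> (v, u) \<in> T" using cross s_link s_sym unfolding T_def by blast
      then show "e \<in> (\<lambda>(a, b). {a, b}) ` T" using \<open>e = {u, v}\<close> by (force simp: insert_commute)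
    qed
    moreover have "finite T" using calculation(1) crossing.finite_T \<open>crossing E T (max_degree G)\<close> by blast
    ultimately show ?thesis using surj_card_le[of T S] by fastforce
  qed
qed

theorem theorem1p10:
  fixes G :: "'a graph" and k :: nat
  assumes "simple_graph G"
    and "k \<ge> 2"
    and "graph_free {cycle_graph 5, cycle_graph (2 * k)} G"
    and "max_degree G \<ge> 1"
  shows "(k \<ge> 4 \<longrightarrow>
            int (strong_clique_number G) \<le> int k * int (max_degree G) - (int k - 1)) \<and>
         (k \<in> {2, 3} \<and> graph_free {cycle_graph 3} G \<longrightarrow>
            int (strong_clique_number G) \<le> int k * int (max_degree G) - (int k - 1))"
proof -
  have free: "graph_free {cycle_graph 5} G" "graph_free {cycle_graph (2 * k)} G"
    using assms(3) graph_free_insert by blast+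
  have "int (strong_clique_number G) \<le> int k * int (max_degree G) - (int k - 1)"
    if "4 \<le> k \<or> graph_free {cycle_graph 3} G"
  proof -
    have bound: "card S + (k - 1) \<le> k * max_degree G" if "strong_clique G S" for S
      using strong_clique_bound[OF assms(1,2,4) free] \<open>4 \<le> k \<or> _\<close> that by blast
    have "finite {S. strong_clique G S}"
      using finite_edges[OF assms(1)] unfolding strong_clique_def
      by (auto intro: finite_subset[of _ "Pow (edges G)"])
    \<comment> \<open>Ensures that \<open>Max\<close> ranges over a nonempty set.\<close>
    moreover have "strong_clique G {}" unfolding strong_clique_def by simp
    ultimately have "strong_clique_number G \<in> card ` {S. strong_clique G S}"
      unfolding strong_clique_number_def by (intro Max_in) auto
    then have "strong_clique_number G + (k - 1) \<le> k * max_degree G" using bound by auto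
    then have "int (strong_clique_number G + (k - 1)) \<le> int (k * max_degree G)" by (rule zle_int[THEN iffD2])
    then show ?thesis using assms(2) by (simp add: of_nat_diff)
  qed
  then show ?thesis by blast
qed

end
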